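(* $\mathsf{Almost\mbox{-}EC}\equiv_{\mathrm W}(\mathsf C_{\mathbb N}\rightarrow\lim)$.
   Context: A represented space $\mathbf X=(X,\delta_X)$ is a set $X$ with a partial surjection $\delta_X:\subseteq\mathbb N^{\mathbb N}\to X$ (the symbol $\subseteq$ marks possibly partial functions). A multi-valued function $f:\subseteq\mathbf X\rightrightarrows\mathbf Y$ assigns to each $x\in\mathrm{dom}(f)\subseteq X$ a nonempty set $f(x)\subseteq Y$. Composition: $z\in(f\circ g)(x)$ iff $g(x)\subseteq\mathrm{dom}(f)$ and $z\in f(y)$ for some $y\in g(x)$ (with $x\in\mathrm{dom}(g)$). $F:\subseteq\mathbb N^{\mathbb N}\to\mathbb N^{\mathbb N}$ is a realizer of $f$, $F\vdash f$, if $\delta_YF(p)\in f\delta_X(p)$ for all $p\in\mathrm{dom}(f\delta_X)$. $f\leq_{\mathrm W}g$ iff there are computable $K,H:\subseteq\mathbb N^{\mathbb N}\to\mathbb N^{\mathbb N}$ with $K\langle\mathrm{id},GH\rangle\vdash f$ for all $G\vdash g$; $\equiv_{\mathrm W}$ is the induced equivalence. Space $\mathcal M(\mathbf X,\mathbf Y)$: fix a universal Turing machine; $\Phi_p:\subseteq\mathbb N^{\mathbb N}\to\mathbb N^{\mathbb N}$ is the partial function it computes with first input $p$, i.e. $\Phi_p(q)=r$ iff on input $\langle p,q\rangle$ it produces the infinite output $r$. Let $\delta_X^{\mathrm{cyl}}\langle p,q\rangle:=\delta_X(p)$, $\Phi_p^{\mathbf X,\mathbf Y}:=\delta_Y\circ\Phi_p\circ(\delta_X^{\mathrm{cyl}})^{-1}$.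 $\mathcal M(\mathbf X,\mathbf Y)$ is the represented space of all $\Phi_p^{\mathbf X,\mathbf Y}$, with $p$ as a name. Implication: for $f:\subseteq\mathbf U\rightrightarrows\mathbf V$ and $g:\subseteq\mathbf X\rightrightarrows\mathbf Y$ with $\mathrm{dom}(g)\neq\emptyset$, $(g\rightarrow f):\subseteq\mathbf U\rightrightarrows\mathcal M(\mathbf Y,\mathbf V)\times\mathbf X$ has domain $\mathrm{dom}(f)$ and $(H,x)\in(g\rightarrow f)(u)$ iff $(H\circ g)(x)\subseteq f(u)$ (where $x\in\mathrm{dom}(H\circ g)$). $\mathcal A(\mathbb N)$ is the space of subsets of $\mathbb N$ where a name of $A$ is an enumeration of the complement $\mathbb N\setminus A$ (negative information); $\mathcal O(\mathbb N)$ is the space of subsets of $\mathbb N$ where a name of $U$ is an enumeration of $U$ (enumerations may also list nothing at a given stage, so the empty set is covered). $\mathsf C_{\mathbb N}:\subseteq\mathcal A(\mathbb N)\rightrightarrows\mathbb N$, $A\mapsto A$, is defined for all nonempty $A$. $\lim:\subseteq\mathbb N^{\mathbb N}\to\mathbb N^{\mathbb N}$ is $\lim(p)(n)=\lim_{i\to\infty}p(\langle n,i\rangle)$, defined when all these limits exist. $\mathsf{Almost\mbox{-}EC}:\mathcal A(\mathbb N)\rightrightarrows\mathcal O(\mathbb N)$ is defined by $U\in\mathsf{Almost\mbox{-}EC}(A)$ iff $(A\setminus U)\cup(U\setminus A)$ is finite. *)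

theory Defs
  imports Complex_Main "HOL-Library.Nat_Bijection" "HOL-Library.Sublist"
begin

section \<open>Baire space\<close>

type_synonym baire = "nat \<Rightarrow> nat"

definition bpair :: "baire \<Rightarrow> baire \<Rightarrow> baire" where
  "bpair p q = (\<lambda>n. if even n then p (n div 2) else q (n div 2))"

definition bfst :: "baire \<Rightarrow> baire" where
  "bfst r = (\<lambda>n. r (2 * n))"

definition bsnd :: "baire \<Rightarrow> baire" where
  "bsnd r = (\<lambda>n. r (2 * n + 1))"

lemma bfst_bpair [simp]: "bfst (bpair p q) = p"
  and bsnd_bpair [simp]: "bsnd (bpair p q) = q"
  and bpair_bfst_bsnd [simp]: "bpair (bfst r) (bsnd r) = r"
  by (auto simp: bfst_def bsnd_def bpair_def fun_eq_iff)

definition prepend :: "nat list \<Rightarrow> baire \<Rightarrow> baire" where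
  "prepend w p = (\<lambda>n. if n < length w then w ! n else p (n - length w))"


section \<open>Turing machines on infinite sequences\<close>

text \<open>
  A machine has a two-way read-only input tape, finitely many two-way infinite work tapes and a
  one-way write-only output tape. On the input and output tapes a sequence p of natural numbers is
  written over a two-letter alphabet in unary, as p(0) strokes, a separator, p(1) strokes, a
  separator, and so on.
\<close>

datatype letter = Stroke | Sep

definition unary :: "baire \<Rightarrow> nat \<Rightarrow> letter list" where
  "unary p n = concat (map (\<lambda>i. replicate (p i) Stroke @ [Sep]) [0..<n])"

text \<open>
  Cell 0 of the input tape carries the left end marker None. Each block of the unary word has
  length at least 1, so the first n + 1 blocks determine its n-th letter.
\<close>

fun input_cell :: "baire \<Rightarrow> nat \<Rightarrow> letter option" where
  "input_cell p 0 = None"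
| "input_cell p (Suc n) = Some (unary p (Suc n) ! n)"

datatype move = Leftward | Stay | Rightward

text \<open>
  A rule maps the state, the scanned input cell and the scanned work symbols to the new
  state, the move of the input head, the symbol to be written and the move for each work tape, and
  the letter to be output (None: no output in this step). The program is a finite list of rules,
  so only finitely many states and work symbols matter. The start state is 0, and the work symbol 0
  is the blank. If several rules have the same left-hand side, the first one counts; if no rule
  applies, the machine stops.
\<close>

type_synonym situation = "nat \<times> letter option \<times> nat list"
type_synonym action = "nat \<times> move \<times> (nat \<times> move) list \<times> letter option"

record tm =
  work_tapes :: nat
  rules :: "(situation \<times> action) list"

definition turing_machine :: "tm \<Rightarrow> bool" where
  "turing_machine M \<longleftrightarrow>
     (\<forall>((s, a, xs), (s', m, ys, b)) \<in> set (rules M).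
        length xs = work_tapes M \<and> length ys = work_tapes M)"

record config =
  state :: nat
  in_head :: nat
  work :: "((int \<Rightarrow> nat) \<times> int) list"  \<comment> \<open>contents and head position of each work tape\<close>
  written :: "letter list"

definition initial :: "tm \<Rightarrow> config" where
  "initial M = \<lparr>state = 0, in_head = 0,
                work = replicate (work_tapes M) (\<lambda>_. 0, 0), written = []\<rparr>"

fun move_in :: "move \<Rightarrow> nat \<Rightarrow> nat" where
  "move_in Leftward i = i - 1"
| "move_in Stay i = i"
| "move_in Rightward i = i + 1"

fun move_work :: "move \<Rightarrow> int \<Rightarrow> int" where
  "move_work Leftward i = i - 1"
| "move_work Stay i = i"
| "move_work Rightward i = i + 1"

fun update_tape :: "(int \<Rightarrow> nat) \<times> int \<Rightarrow> nat \<times> move \<Rightarrow> (int \<Rightarrow> nat) \<times> int" where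
  "update_tape (t, h) (y, m) = (t(h := y), move_work m h)"

definition step :: "tm \<Rightarrow> baire \<Rightarrow> config \<Rightarrow> config" where
  "step M p c =
     (case map_of (rules M)
             (state c, input_cell p (in_head c), map (\<lambda>(t, h). t h) (work c)) of
        None \<Rightarrow> c
      | Some (s, m, ys, b) \<Rightarrow>
          \<lparr>state = s, in_head = move_in m (in_head c), work = map2 update_tape (work c) ys,
           written = written c @ (case b of None \<Rightarrow> [] | Some l \<Rightarrow> [l])\<rparr>)"

definition output_after :: "tm \<Rightarrow> baire \<Rightarrow> nat \<Rightarrow> letter list" where
  "output_after M p t = written ((step M p ^^ t) (initial M))"

definition produces :: "tm \<Rightarrow> baire \<Rightarrow> baire \<Rightarrow> bool" where
  "produces M p r \<longleftrightarrow> (\<forall>n. \<exists>t. prefix (unary r n) (output_after M p t))"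

definition tm_fun :: "tm \<Rightarrow> baire \<rightharpoonup> baire" where
  "tm_fun M p = (if \<exists>r. produces M p r then Some (THE r. produces M p r) else None)"

lemma unary_Suc: "unary p (Suc n) = unary p n @ replicate (p n) Stroke @ [Sep]"
  by (simp add: unary_def)

lemma output_after_mono: "s \<le> t \<Longrightarrow> prefix (output_after M p s) (output_after M p t)"
proof (induction t rule: dec_induct)
  case (step t)
  have "prefix (output_after M p t) (output_after M p (Suc t))"
    by (simp add: output_after_def step_def split: option.split prod.split)
  with step.IH show ?case
    by (rule prefix_order.trans)
qed simp

lemma replicate_Sep_prefix:
  "prefix (replicate a Stroke @ Sep # xs) ys \<Longrightarrow> prefix (replicate b Stroke @ Sep # xs') ys \<Longrightarrow> a = b"
proof (induction a arbitrary: b ys)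
  case 0
  then show ?case by (cases b; cases ys) auto
next
  case (Suc a)
  then show ?case by (cases b; cases ys) auto
qed

text \<open>The definite description in the definition of \<^const>\<open>tm_fun\<close> is justified.\<close>

lemma produces_unique:
  assumes "produces M p r" "produces M p r'"
  shows "r = r'"
proof
  fix n
  show "r n = r' n"
  proof (induction n rule: less_induct)
    case (less n)
    obtain s t where "prefix (unary r (Suc n)) (output_after M p s)"
      and "prefix (unary r' (Suc n)) (output_after M p t)"
      using assms unfolding produces_def by metis
    then have "prefix (unary r (Suc n)) (output_after M p (max s t))"
      and "prefix (unary r' (Suc n)) (output_after M p (max s t))"
      by (meson output_after_mono prefix_order.trans max.cobounded1 max.cobounded2)+
    moreover have "unary r n = unary r' n"
      unfolding unary_def using less by (intro arg_cong[where f = concat] map_cong) auto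
    ultimately show ?case
      by (auto simp: unary_Suc prefix_def) (metis prefixI append.assoc append_Cons
          replicate_Sep_prefix)
  qed
qed

text \<open>
  As usual for partial functions on Baire space, a machine computes F if it gives the right output
  on the domain of F; its behaviour on other inputs is irrelevant.
\<close>

definition computable :: "(baire \<rightharpoonup> baire) \<Rightarrow> bool" where
  "computable F \<longleftrightarrow> (\<exists>M. turing_machine M \<and> (\<forall>p \<in> dom F. tm_fun M p = F p))"

text \<open>
  A universal machine simulates every machine M on input (p, q) when a suitable finite program for M
  is put in front of the first argument p.
\<close>

definition universal :: "tm \<Rightarrow> bool" where
  "universal U \<longleftrightarrow> turing_machine U \<and>
     (\<forall>M. turing_machine M \<longrightarrow>
        (\<exists>w. \<forall>p q. tm_fun U (bpair (prepend w p) q) = tm_fun M (bpair p q)))"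

definition Phi :: "tm \<Rightarrow> baire \<Rightarrow> baire \<rightharpoonup> baire" where
  "Phi U p q = tm_fun U (bpair p q)"


section \<open>Represented spaces and multi-valued functions\<close>

text \<open>
  A represented space is given by its representation; the underlying set is the range, so that the
  representation is surjective.
\<close>

type_synonym 'a rspace = "baire \<rightharpoonup> 'a"

abbreviation points :: "'a rspace \<Rightarrow> 'a set" where
  "points X \<equiv> ran X"

text \<open>A partial multi-valued function takes the value \<open>{}\<close> exactly outside its domain.\<close>

type_synonym ('a, 'b) mvf = "'a \<Rightarrow> 'b set"

definition mdom :: "('a, 'b) mvf \<Rightarrow> 'a set" where
  "mdom f = {x. f x \<noteq> {}}"

definition mcomp :: "('b, 'c) mvf \<Rightarrow> ('a, 'b) mvf \<Rightarrow> ('a, 'c) mvf" (infixl \<open>\<circ>\<^sub>m\<^sub>v\<close> 55) where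
  "(f \<circ>\<^sub>m\<^sub>v g) x = {z. x \<in> mdom g \<and> g x \<subseteq> mdom f \<and> (\<exists>y \<in> g x. z \<in> f y)}"

definition mv :: "('a \<rightharpoonup> 'b) \<Rightarrow> ('a, 'b) mvf" where
  "mv F x = set_option (F x)"

definition mv_inv :: "('a \<rightharpoonup> 'b) \<Rightarrow> ('b, 'a) mvf" where
  "mv_inv F y = {x. F x = Some y}"

definition prod_space :: "'a rspace \<Rightarrow> 'b rspace \<Rightarrow> ('a \<times> 'b) rspace" where
  "prod_space X Y r =
     (case (X (bfst r), Y (bsnd r)) of (Some x, Some y) \<Rightarrow> Some (x, y) | _ \<Rightarrow> None)"

definition cyl :: "'a rspace \<Rightarrow> 'a rspace" where
  "cyl X r = X (bfst r)"

definition Phi_space :: "tm \<Rightarrow> 'a rspace \<Rightarrow> 'b rspace \<Rightarrow> baire \<Rightarrow> ('a, 'b) mvf" where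
  "Phi_space U X Y p = mv Y \<circ>\<^sub>m\<^sub>v mv (Phi U p) \<circ>\<^sub>m\<^sub>v mv_inv (cyl X)"

definition M_space :: "tm \<Rightarrow> 'a rspace \<Rightarrow> 'b rspace \<Rightarrow> ('a, 'b) mvf rspace" where
  "M_space U X Y p = Some (Phi_space U X Y p)"


section \<open>Weihrauch reducibility and implication\<close>

record ('a, 'b) problem =
  source :: "'a rspace"
  target :: "'b rspace"
  mvfun :: "('a, 'b) mvf"

definition realizes :: "(baire \<rightharpoonup> baire) \<Rightarrow> ('a, 'b) problem \<Rightarrow> bool" (infix \<open>\<turnstile>\<close> 50) where
  "F \<turnstile> f \<longleftrightarrow>
     (\<forall>p x. source f p = Some x \<and> x \<in> mdom (mvfun f) \<longrightarrow>
        (\<exists>q y. F p = Some q \<and> target f q = Some y \<and> y \<in> mvfun f x))"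

definition weihrauch_le :: "('a, 'b) problem \<Rightarrow> ('c, 'd) problem \<Rightarrow> bool" (infix \<open>\<le>\<^sub>W\<close> 50) where
  "f \<le>\<^sub>W g \<longleftrightarrow>
     (\<exists>K H. computable K \<and> computable H \<and>
        (\<forall>G. G \<turnstile> g \<longrightarrow>
           (\<lambda>p. Option.bind (Option.bind (H p) G) (\<lambda>r. K (bpair p r))) \<turnstile> f))"

definition weihrauch_eq :: "('a, 'b) problem \<Rightarrow> ('c, 'd) problem \<Rightarrow> bool" (infix \<open>\<equiv>\<^sub>W\<close> 50) where
  "f \<equiv>\<^sub>W g \<longleftrightarrow> f \<le>\<^sub>W g \<and> g \<le>\<^sub>W f"

definition implication ::
  "tm \<Rightarrow> ('x, 'y) problem \<Rightarrow> ('u, 'v) problem \<Rightarrow> ('u, ('y, 'v) mvf \<times> 'x) problem" where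
  "implication U g f =
     \<lparr>source = source f,
      target = prod_space (M_space U (target g) (target f)) (source g),
      mvfun = (\<lambda>u. {(H, x). u \<in> mdom (mvfun f) \<and>
                 H \<in> points (M_space U (target g) (target f)) \<and> x \<in> points (source g) \<and>
                 x \<in> mdom (H \<circ>\<^sub>m\<^sub>v mvfun g) \<and> (H \<circ>\<^sub>m\<^sub>v mvfun g) x \<subseteq> mvfun f u})\<rparr>"


section \<open>The problems\<close>

definition nat_space :: "nat rspace" where
  "nat_space p = Some (p 0)"

definition baire_space :: "baire rspace" where
  "baire_space p = Some p"

text \<open>In an enumeration, \<open>Suc n\<close> lists n and 0 lists nothing.\<close>

definition enumerated :: "baire \<Rightarrow> nat set" where
  "enumerated p = {n. \<exists>i. p i = Suc n}"

definition open_space :: "nat set rspace" where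
  "open_space p = Some (enumerated p)"

definition closed_space :: "nat set rspace" where
  "closed_space p = Some (- enumerated p)"

definition C_Nat :: "(nat set, nat) problem" where
  "C_Nat = \<lparr>source = closed_space, target = nat_space, mvfun = (\<lambda>A. A)\<rparr>"

definition Lim_problem :: "(baire, baire) problem" where
  "Lim_problem = \<lparr>source = baire_space, target = baire_space,
     mvfun = (\<lambda>p. {r. \<forall>n. (\<lambda>i. p (prod_encode (n, i))) \<longlonglongrightarrow> r n})\<rparr>"

definition Almost_EC :: "(nat set, nat set) problem" where
  "Almost_EC = \<lparr>source = closed_space, target = open_space,
     mvfun = (\<lambda>A. {U. finite ((A - U) \<union> (U - A))})\<rparr>"

end

theory Submission
  imports Defs "HOL-Library.Countable"
begin

text \<open>
  Given a name p of A, put \<open>s\<langle>n,i\<rangle> = 1\<close> if n has not been listed by p before stage i, and 0 otherwise,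
  so that the limit of s is the characteristic function of A. From a solution (H, X) of the
  implication for s, compute at stage t a guess \<open>n\<^sub>t\<close> for the least element of X and simulate H on
  \<open>n\<^sub>t\<close> for t steps; list k when the last of these steps wrote a stroke of the k-th output block. The
  guess is eventually final, and then correct, so only finitely many k are affected by earlier
  stages.

  Conversely, let p be convergent and let A be the set of the pairs \<open>\<langle>n,i\<rangle>\<close> with
  \<open>p\<langle>n,j\<rangle> = p\<langle>n,i\<rangle>\<close> for all \<open>j \<ge> i\<close>. If U is almost equal to A, then the set X of all m such
  that U contains no number \<open>c \<ge> m\<close> outside A is co-enumerable and nonempty. Given \<open>m \<in> X\<close>, the limit at n
  is found by searching for some \<open>\<langle>n,i\<rangle> \<ge> m\<close> in U: its value is \<open>p\<langle>n,i\<rangle>\<close>.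

  For the Turing machines it suffices that primitive recursive functionals and unbounded searches
  over them can be implemented. They are compiled to counter programs, whose continuation stacks
  become the states of a machine.
\<close>


section \<open>Counter programs\<close>

text \<open>The Boolean of \<open>Cell\<close> is a polarity: \<open>Cell True a\<close> asks
  whether the scanned cell equals \<open>a\<close>, \<open>Cell False a\<close> whether it
  differs.\<close>

datatype test = Nonzero nat | Cell bool "letter option" | Always

datatype com =
    Inc nat
  | Dec nat
  | Shift move
  | Out letter
  | Seq com com (infixr \<open>;;\<close> 60)
  | Cond test com com
  | While test com

text \<open>Countability makes \<open>to_nat\<close> available on continuation stacks, which become
  machine states.\<close>

instance letter :: countable by countable_datatype
instance move :: countable by countable_datatype
instance test :: countable by countable_datatype
instance com :: countable by countable_datatype

type_synonym store = "(nat \<Rightarrow> nat) \<times> nat \<times> letter list"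

fun holds :: "test \<Rightarrow> letter option \<Rightarrow> (nat \<Rightarrow> bool) \<Rightarrow> bool" where
  "holds (Nonzero r) a z = (\<not> z r)"
| "holds (Cell b a') a z = ((a = a') = b)"
| "holds Always a z = True"

text \<open>The result consists of the new continuation stack, the move of the input head, the change of
  each register and the output. The predicate \<^term>\<open>z\<close> tells which registers are zero.\<close>

fun com_trans :: "com \<Rightarrow> com list \<Rightarrow> letter option \<Rightarrow> (nat \<Rightarrow> bool) \<Rightarrow>
    com list \<times> move \<times> (nat \<Rightarrow> move) \<times> letter option" where
  "com_trans (Inc r) ks a z = (ks, Stay, (\<lambda>_. Stay)(r := Rightward), None)"
| "com_trans (Dec r) ks a z = (ks, Stay, (\<lambda>_. Stay)(r := if z r then Stay else Leftward), None)"
| "com_trans (Shift m) ks a z = (ks, m, \<lambda>_. Stay, None)"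
| "com_trans (Out l) ks a z = (ks, Stay, \<lambda>_. Stay, Some l)"
| "com_trans (c ;; d) ks a z = (c # d # ks, Stay, \<lambda>_. Stay, None)"
| "com_trans (Cond t c d) ks a z = ((if holds t a z then c else d) # ks, Stay, \<lambda>_. Stay, None)"
| "com_trans (While t c) ks a z = (if holds t a z then c # While t c # ks else ks, Stay, \<lambda>_. Stay, None)"

fun com_step :: "baire \<Rightarrow> com list \<times> store \<Rightarrow> com list \<times> store" where
  "com_step x ([], s) = ([], s)"
| "com_step x (c # ks, \<rho>, h, w) =
     (case com_trans c ks (input_cell x h) (\<lambda>r. \<rho> r = 0) of
       (ks', m, v, b) \<Rightarrow> (ks', \<lambda>r. move_in (v r) (\<rho> r), move_in m h,
          w @ (case b of None \<Rightarrow> [] | Some l \<Rightarrow> [l])))"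

text \<open>Quantifying over the rest \<open>ks\<close> of the stack makes executions composable: a
  command pops itself and leaves what lies below it as it was.\<close>

definition exec :: "baire \<Rightarrow> com \<Rightarrow> store \<Rightarrow> store \<Rightarrow> bool" where
  "exec x c s s' \<longleftrightarrow> (\<forall>ks. \<exists>t. (com_step x ^^ t) (c # ks, s) = (ks, s'))"


subsection \<open>Translation into Turing machines\<close>

text \<open>Contains every stack that can occur while \<open>c\<close> runs on top of
  \<open>ks\<close>. The body of a loop returns to the stack of the loop itself, so one recursion
  over the syntax covers all rounds and the set stays finite.\<close>

fun conts :: "com \<Rightarrow> com list \<Rightarrow> com list set" where
  "conts (c ;; d) ks = insert ((c ;; d) # ks) (conts c (d # ks) \<union> conts d ks)"
| "conts (Cond t c d) ks = insert (Cond t c d # ks) (conts c ks \<union> conts d ks)"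
| "conts (While t c) ks = insert (While t c # ks) (conts c (While t c # ks))"
| "conts c ks = {c # ks}"

lemma finite_conts [simp]: "finite (conts c ks)"
  by (induction c arbitrary: ks) auto

lemma Cons_in_conts [simp]: "c # ks \<in> conts c ks"
  by (cases c) auto

text \<open>A finished command pops to the stack of the next command, which is covered by
  \<open>Cons_in_conts\<close>, or to \<open>ks\<close> itself. Hence finitely many machine states
  suffice.\<close>

lemma conts_closed:
  "c' # ks' \<in> conts c ks \<Longrightarrow> fst (com_trans c' ks' a z) \<in> insert ks (conts c ks)"
proof (induction c arbitrary: ks)
  case (Seq c d)
  then show ?case using Seq.IH(1)[of "d # ks"] Seq.IH(2)[of ks] by fastforce
next
  case (Cond t c d)
  then consider "c' # ks' = Cond t c d # ks" | "c' # ks' \<in> conts c ks" | "c' # ks' \<in> conts d ks"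
    by auto
  then show ?case
    using Cond.IH(1)[of ks] Cond.IH(2)[of ks] by cases auto
next
  case (While t c)
  then show ?case using While.IH[of "While t c # ks"] by fastforce
qed auto

fun test_bound :: "test \<Rightarrow> nat" where
  "test_bound (Nonzero r) = Suc r"
| "test_bound _ = 0"

fun reg_bound :: "com \<Rightarrow> nat" where
  "reg_bound (Inc r) = Suc r"
| "reg_bound (Dec r) = Suc r"
| "reg_bound (c ;; d) = max (reg_bound c) (reg_bound d)"
| "reg_bound (Cond t c d) = max (test_bound t) (max (reg_bound c) (reg_bound d))"
| "reg_bound (While t c) = max (test_bound t) (reg_bound c)"
| "reg_bound _ = 0"

text \<open>A step reads registers only through tests and \<open>Dec\<close>, so it depends only on
  which registers below \<open>k\<close> are zero; this is what \<open>k\<close> work tapes can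
  report.\<close>

lemma trans_cong:
  assumes "reg_bound c \<le> k" and "\<And>r. r < k \<Longrightarrow> z r = z' r"
  shows "com_trans c ks a z = com_trans c ks a z'"
proof -
  have "holds t a z = holds t a z'" if "test_bound t \<le> k" for t
    using that assms(2) by (cases t) auto
  then show ?thesis
    using assms by (cases c) (auto simp: fun_eq_iff)
qed

text \<open>A register is a work tape whose only nonblank cell is the origin; its value is the position of
  the head. State 0 marks the origins, and state \<open>Suc (to_nat ks)\<close> represents the stack \<open>ks\<close>.\<close>

definition com_action :: "nat \<Rightarrow> com \<Rightarrow> situation \<Rightarrow> action" where
  "com_action k main = (\<lambda>(q, a, xs).
     if q = 0 then (Suc (to_nat [main]), Stay, replicate k (1, Stay), None)
     else case from_nat (q - 1) :: com list of
         [] \<Rightarrow> (q, Stay, map (\<lambda>y. (y, Stay)) xs, None)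
       | c # ks \<Rightarrow>
          (case com_trans c ks a (\<lambda>r. xs ! r = 1) of
            (ks', m, v, b) \<Rightarrow> (Suc (to_nat ks'), m, map (\<lambda>r. (xs ! r, v r)) [0..<k], b)))"

text \<open>The empty stack has keys too: there the machine idles, as \<open>com_step\<close> does.
  Symbol 1 is the mark of the origin, 0 the blank.\<close>

definition com_keys :: "nat \<Rightarrow> com \<Rightarrow> situation set" where
  "com_keys k main =
     insert 0 ((Suc \<circ> to_nat) ` insert [] (conts main [])) \<times> {None, Some Stroke, Some Sep} \<times>
       {xs. set xs \<subseteq> {0, 1} \<and> length xs = k}"

text \<open>The action is a function of the key, so every listing of the finite key set gives the
  same behaviour and the choice by \<open>SOME\<close> is harmless.\<close>

definition com_tm :: "nat \<Rightarrow> com \<Rightarrow> tm" where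
  "com_tm k main = \<lparr>work_tapes = k,
     rules = map (\<lambda>s. (s, com_action k main s)) (SOME ks. set ks = com_keys k main)\<rparr>"

lemma set_com_keys: "set (SOME ks. set ks = com_keys k main) = com_keys k main"
proof -
  have "finite (com_keys k main)"
    unfolding com_keys_def by (intro finite_cartesian_product finite_lists_length_eq) auto
  then show ?thesis
    using finite_list by (metis (mono_tags, lifting) someI_ex)
qed

lemma turing_machine_com_tm: "turing_machine (com_tm k main)"
proof -
  have "set (rules (com_tm k main)) = (\<lambda>s. (s, com_action k main s)) ` com_keys k main"
    by (simp add: com_tm_def set_com_keys)
  moreover have "work_tapes (com_tm k main) = k"
    by (simp add: com_tm_def)
  ultimately show ?thesis
    unfolding turing_machine_def
    by (auto simp: com_keys_def com_action_def split: list.splits if_splits prod.splits)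
qed

lemma map_of_com_tm:
  "s \<in> com_keys k main \<Longrightarrow> map_of (rules (com_tm k main)) s = Some (com_action k main s)"
  by (simp add: com_tm_def map_of_map_restrict set_com_keys)

definition represents :: "nat \<Rightarrow> config \<Rightarrow> com list \<times> store \<Rightarrow> bool" where
  "represents k C = (\<lambda>(ks, \<rho>, h, w).
     C = \<lparr>state = Suc (to_nat ks), in_head = h,
          work = map (\<lambda>r. ((\<lambda>_. 0)(0 := 1), int (\<rho> r))) [0..<k], written = w\<rparr>)"

lemma letter_option_cases: "(a :: letter option) \<in> {None, Some Stroke, Some Sep}"
  by (cases a; cases "the a") auto

lemma step_com_tm:
  assumes C: "represents k C (ks, \<rho>, h, w)"
    and ks: "ks \<in> insert [] (conts main [])"
    and k: "\<And>c. c \<in> set ks \<Longrightarrow> reg_bound c \<le> k"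
  shows "represents k (step (com_tm k main) x C) (com_step x (ks, \<rho>, h, w))"
    and "fst (com_step x (ks, \<rho>, h, w)) \<in> insert [] (conts main [])"
proof -
  \<comment> \<open>The head of tape \<open>r\<close> scans the mark exactly when register
    \<open>r\<close> is zero.\<close>
  define z :: "nat list" where "z = map (\<lambda>r. if \<rho> r = 0 then 1 else 0) [0..<k]"
  have sit: "(state C, input_cell x (in_head C), map (\<lambda>(t, h). t h) (work C))
      = (Suc (to_nat ks), input_cell x h, z)"
    using C by (auto simp: represents_def z_def)
  have "(Suc (to_nat ks), input_cell x h, z) \<in> com_keys k main"
    using ks letter_option_cases[of "input_cell x h"]
    by (auto simp: com_keys_def z_def)
  then have st: "map_of (rules (com_tm k main))
      (state C, input_cell x (in_head C), map (\<lambda>(t, h). t h) (work C))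
      = Some (com_action k main (Suc (to_nat ks), input_cell x h, z))"
    unfolding sit by (rule map_of_com_tm)
  show "represents k (step (com_tm k main) x C) (com_step x (ks, \<rho>, h, w))"
  proof (cases ks)
    case Nil
    then show ?thesis
      using C unfolding step_def st
      by (auto simp: com_action_def represents_def z_def map2_map_map fun_eq_iff)
  next
    case (Cons c ks')
    obtain st' m v b where tr: "com_trans c ks' (input_cell x h) (\<lambda>r. \<rho> r = 0) = (st', m, v, b)"
      by (metis prod_cases4)
    have tr': "com_trans c ks' (input_cell x h) (\<lambda>r. z ! r = 1) = (st', m, v, b)"
      unfolding tr[symmetric] using k Cons by (intro trans_cong[of _ k]) (auto simp: z_def)
    have act: "com_action k main (Suc (to_nat ks), input_cell x h, z)
        = (Suc (to_nat st'), m, map (\<lambda>r. (z ! r, v r)) [0..<k], b)"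
      using tr' Cons by (simp add: com_action_def)
    \<comment> \<open>The two kinds of move differ only for a left move at position 0, which
      \<open>Dec\<close> avoids at a zero register.\<close>
    have mv: "move_work (v r) (int (\<rho> r)) = int (move_in (v r) (\<rho> r))" for r
      using tr by (cases c) auto
    have mark: "(\<lambda>_. 0)(0 := 1, int (\<rho> r) := z ! r) = (\<lambda>_. 0)(0 := 1)" if "r < k" for r
      using that by (auto simp: z_def fun_eq_iff)
    have "map2 update_tape (work C) (map (\<lambda>r. (z ! r, v r)) [0..<k])
        = map (\<lambda>r. ((\<lambda>_. 0)(0 := 1), int (move_in (v r) (\<rho> r)))) [0..<k]"
      using C mark by (simp add: represents_def map2_map_map mv cong: map_cong)
    then show ?thesis
      using C tr Cons unfolding step_def st act by (simp add: represents_def)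
  qed
  show "fst (com_step x (ks, \<rho>, h, w)) \<in> insert [] (conts main [])"
  proof (cases ks)
    case (Cons c ks')
    then show ?thesis
      using conts_closed[of c ks' main "[]" "input_cell x h" "\<lambda>r. \<rho> r = 0"] ks
      by (auto split: prod.split)
  qed simp
qed

lemma ex_tm_simulating:
  "\<exists>M. turing_machine M \<and>
     (\<forall>x t. \<exists>T. output_after M x T =
        snd (snd (snd ((com_step x ^^ t) ([main], \<lambda>_. 0, 0, [])))))"
proof -
  define S where "S = insert [] (conts main [])"
  \<comment> \<open>This bounds the registers of every command that can appear on a stack.\<close>
  define k where "k = Max (reg_bound ` \<Union> (set ` S))"
  have k: "reg_bound c \<le> k" if "ks \<in> S" "c \<in> set ks" for c ks
    unfolding k_def using that by (intro Max_ge) (auto simp: S_def)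
  let ?M = "com_tm k main"
  let ?s = "\<lambda>x t. (com_step x ^^ t) ([main], \<lambda>_. 0, 0, [])"
  have init: "represents k (step ?M x (initial ?M)) ([main], \<lambda>_. 0, 0, [])" for x
  proof -
    have wt: "work_tapes ?M = k"
      by (simp add: com_tm_def)
    have key: "(0, None, replicate k 0) \<in> com_keys k main"
      by (auto simp: com_keys_def)
    show ?thesis
      using map_of_com_tm[OF key]
      by (simp add: step_def initial_def wt represents_def com_action_def map_replicate_const
          zip_replicate)
  qed
  \<comment> \<open>The first machine step marks the origins, so the machine runs one step behind
    the program.\<close>
  have sim: "represents k ((step ?M x ^^ Suc t) (initial ?M)) (?s x t) \<and> fst (?s x t) \<in> S" for x t
  proof (induction t)
    case 0
    then show ?case using init by (simp add: S_def)
  next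
    case (Suc t)
    obtain ks \<rho> h w where s: "?s x t = (ks, \<rho>, h, w)"
      by (metis prod_cases4)
    then have "ks \<in> S" "represents k ((step ?M x ^^ Suc t) (initial ?M)) (ks, \<rho>, h, w)"
      using Suc by simp_all
    then show ?case
      using step_com_tm[of k "(step ?M x ^^ Suc t) (initial ?M)" ks \<rho> h w main x] k s
      by (simp add: S_def)
  qed
  have "output_after ?M x (Suc t) = snd (snd (snd (?s x t)))" for x t
    using sim[of t x] by (auto simp: represents_def output_after_def split: prod.splits)
  then show ?thesis
    using turing_machine_com_tm by blast
qed

subsection \<open>Execution rules\<close>

definition reaches :: "baire \<Rightarrow> com list \<times> store \<Rightarrow> com list \<times> store \<Rightarrow> bool" where
  "reaches x a b \<longleftrightarrow> (\<exists>t. (com_step x ^^ t) a = b)"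

lemma reaches_refl [simp]: "reaches x a a"
  unfolding reaches_def by (intro exI[of _ 0]) simp

lemma reaches_trans: "reaches x a b \<Longrightarrow> reaches x b c \<Longrightarrow> reaches x a c"
  unfolding reaches_def by (metis funpow_add comp_apply)

lemma reaches_step: "com_step x a = b \<Longrightarrow> reaches x a b"
  unfolding reaches_def by (intro exI[of _ 1]) simp

lemma exec_iff_reaches: "exec x c s s' \<longleftrightarrow> (\<forall>ks. reaches x (c # ks, s) (ks, s'))"
  by (simp add: exec_def reaches_def)

lemma exec_eq: "exec x c s s' \<Longrightarrow> s = t \<Longrightarrow> s' = t' \<Longrightarrow> exec x c t t'"
  by simp

lemma exec_Inc: "\<rho>' = \<rho>(r := Suc (\<rho> r)) \<Longrightarrow> exec x (Inc r) (\<rho>, h, w) (\<rho>', h, w)"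
  unfolding exec_iff_reaches by (auto intro!: reaches_step simp: fun_eq_iff)

lemma exec_Dec: "\<rho>' = \<rho>(r := \<rho> r - 1) \<Longrightarrow> exec x (Dec r) (\<rho>, h, w) (\<rho>', h, w)"
  unfolding exec_iff_reaches by (auto intro!: reaches_step simp: fun_eq_iff)

lemma exec_Shift: "h' = move_in m h \<Longrightarrow> exec x (Shift m) (\<rho>, h, w) (\<rho>, h', w)"
  unfolding exec_iff_reaches by (auto intro!: reaches_step)

lemma exec_Out: "exec x (Out l) (\<rho>, h, w) (\<rho>, h, w @ [l])"
  unfolding exec_iff_reaches by (auto intro!: reaches_step)

lemma exec_Seq: "exec x c s s' \<Longrightarrow> exec x d s' s'' \<Longrightarrow> exec x (c ;; d) s s''"
  unfolding exec_iff_reaches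
proof
  fix ks
  assume "\<forall>ks. reaches x (c # ks, s) (ks, s')" "\<forall>ks. reaches x (d # ks, s') (ks, s'')"
  moreover have "reaches x ((c ;; d) # ks, s) (c # d # ks, s)"
    by (cases s) (auto intro!: reaches_step)
  ultimately show "reaches x ((c ;; d) # ks, s) (ks, s'')"
    by (meson reaches_trans)
qed

definition true_at :: "baire \<Rightarrow> test \<Rightarrow> (nat \<Rightarrow> nat) \<Rightarrow> nat \<Rightarrow> bool" where
  "true_at x t \<rho> h = holds t (input_cell x h) (\<lambda>r. \<rho> r = 0)"

lemma true_at_simps [simp]:
  "true_at x (Nonzero r) \<rho> h \<longleftrightarrow> \<rho> r \<noteq> 0"
  "true_at x (Cell b a) \<rho> h \<longleftrightarrow> (input_cell x h = a) = b"
  "true_at x Always \<rho> h"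
  by (simp_all add: true_at_def)

lemma exec_Cond:
  assumes "exec x (if true_at x t \<rho> h then c else d) (\<rho>, h, w) s'"
  shows "exec x (Cond t c d) (\<rho>, h, w) s'"
  unfolding exec_iff_reaches
proof
  fix ks
  have "reaches x (Cond t c d # ks, \<rho>, h, w)
      ((if true_at x t \<rho> h then c else d) # ks, \<rho>, h, w)"
    by (auto intro!: reaches_step simp: true_at_def)
  then show "reaches x (Cond t c d # ks, \<rho>, h, w) (ks, s')"
    using assms unfolding exec_iff_reaches by (meson reaches_trans)
qed

lemma exec_While_False:
  "\<not> true_at x t \<rho> h \<Longrightarrow> exec x (While t c) (\<rho>, h, w) (\<rho>, h, w)"
  unfolding exec_iff_reaches true_at_def by (auto intro!: reaches_step)

lemma exec_While_True:
  assumes "true_at x t \<rho> h"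
    and "exec x c (\<rho>, h, w) s'" and "exec x (While t c) s' s''"
  shows "exec x (While t c) (\<rho>, h, w) s''"
  unfolding exec_iff_reaches
proof
  fix ks
  have "reaches x (While t c # ks, \<rho>, h, w) (c # While t c # ks, \<rho>, h, w)"
    using assms(1) by (auto intro!: reaches_step simp: true_at_def)
  then show "reaches x (While t c # ks, \<rho>, h, w) (ks, s'')"
    using assms(2,3) unfolding exec_iff_reaches by (meson reaches_trans)
qed

definition Loop :: "nat \<Rightarrow> com \<Rightarrow> com" where
  "Loop a c = While (Nonzero a) (Dec a ;; c)"

text \<open>\<open>\<rho> j\<close> describes the store after \<open>j\<close> rounds up to the
  counter \<open>a\<close>, which is overwritten separately; the body must work for every value
  \<open>v\<close> of the counter and preserve it.\<close>

lemma exec_Loop: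
  assumes "\<And>j v. j < n \<Longrightarrow>
      exec x c ((\<rho> j)(a := v), h j, w j) ((\<rho> (Suc j))(a := v), h (Suc j), w (Suc j))"
  shows "exec x (Loop a c) ((\<rho> 0)(a := n), h 0, w 0) ((\<rho> n)(a := 0), h n, w n)"
proof -
  have "exec x (Loop a c) ((\<rho> k)(a := m), h k, w k) ((\<rho> n)(a := 0), h n, w n)"
    if "k + m = n" for k m
    using that
  proof (induction m arbitrary: k)
    case 0
    then show ?case
      unfolding Loop_def by (auto intro!: exec_While_False)
  next
    case (Suc m)
    have "exec x (Dec a ;; c) ((\<rho> k)(a := Suc m), h k, w k)
        ((\<rho> (Suc k))(a := m), h (Suc k), w (Suc k))"
      using Suc.prems by (intro exec_Seq[OF exec_Dec[OF refl]]) (simp add: assms)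
    moreover have "exec x (Loop a c)
        ((\<rho> (Suc k))(a := m), h (Suc k), w (Suc k)) ((\<rho> n)(a := 0), h n, w n)"
      by (rule Suc.IH) (use Suc.prems in simp)
    ultimately show ?case
      unfolding Loop_def by (intro exec_While_True) simp
  qed
  then show ?thesis
    by simp
qed

text \<open>Variant for bodies that query the input and leave the head at an unspecified
  place.\<close>

lemma exec_Loop_any_head:
  assumes "\<And>j v h. \<exists>h'. exec x c ((\<rho> j)(a := v), h, w) ((\<rho> (Suc j))(a := v), h', w)"
  shows "\<exists>h'. exec x (Loop a c) ((\<rho> 0)(a := n), h, w) ((\<rho> n)(a := 0), h', w)"
proof -
  have "\<exists>h'. exec x (Loop a c) ((\<rho> k)(a := m), h, w) ((\<rho> (k + m))(a := 0), h', w)" for k m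
  proof (induction m arbitrary: k h)
    case 0
    have "exec x (Loop a c) ((\<rho> k)(a := 0), h, w) ((\<rho> (k + 0))(a := 0), h, w)"
      using exec_While_False[of x "Nonzero a" "(\<rho> k)(a := 0)" h] by (simp add: Loop_def)
    then show ?case ..
  next
    case (Suc m)
    obtain h1 where "exec x c ((\<rho> k)(a := m), h, w) ((\<rho> (Suc k))(a := m), h1, w)"
      using assms by blast
    then have "exec x (Dec a ;; c) ((\<rho> k)(a := Suc m), h, w) ((\<rho> (Suc k))(a := m), h1, w)"
      by (intro exec_Seq[OF exec_Dec[OF refl]]) simp
    moreover have "\<exists>h2. exec x (Loop a c)
        ((\<rho> (Suc k))(a := m), h1, w) ((\<rho> (Suc k + m))(a := 0), h2, w)"
      by (rule Suc.IH)
    then obtain h2 where "exec x (Loop a c)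
        ((\<rho> (Suc k))(a := m), h1, w) ((\<rho> (k + Suc m))(a := 0), h2, w)"
      by auto
    ultimately have "exec x (Loop a c) ((\<rho> k)(a := Suc m), h, w)
        ((\<rho> (k + Suc m))(a := 0), h2, w)"
      unfolding Loop_def by (intro exec_While_True) simp
    then show ?case ..
  qed
  from this[of 0 n] show ?thesis
    by simp
qed

section \<open>Register transfers and the pairing function on registers\<close>

lemma exec_transfer:
  assumes "a \<noteq> b" "\<rho>' = \<rho>(a := 0, b := \<rho> b + \<rho> a)"
  shows "exec x (Loop a (Inc b)) (\<rho>, h, w) (\<rho>', h, w)"
  by (rule exec_eq[OF exec_Loop[of "\<rho> a" x _ "\<lambda>j. \<rho>(b := \<rho> b + j)" _ "\<lambda>_. h" "\<lambda>_. w"]])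
    (use assms in \<open>auto intro!: exec_Inc simp: fun_eq_iff\<close>)

lemma exec_transfer2:
  assumes "distinct [a, b, c]" "\<rho>' = \<rho>(a := 0, b := \<rho> b + \<rho> a, c := \<rho> c + \<rho> a)"
  shows "exec x (Loop a (Inc b ;; Inc c)) (\<rho>, h, w) (\<rho>', h, w)"
  by (rule exec_eq[OF exec_Loop[of "\<rho> a" x _ "\<lambda>j. \<rho>(b := \<rho> b + j, c := \<rho> c + j)" _
          "\<lambda>_. h" "\<lambda>_. w"]])
    (use assms in \<open>auto intro!: exec_Seq[OF exec_Inc[OF refl]] exec_Inc simp: fun_eq_iff\<close>)

definition Clear :: "nat \<Rightarrow> com" where
  "Clear d = While (Nonzero d) (Dec d)"

lemma exec_Clear: "\<rho>' = \<rho>(d := 0) \<Longrightarrow> exec x (Clear d) (\<rho>, h, w) (\<rho>', h, w)"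
  unfolding Clear_def
proof (induction "\<rho> d" arbitrary: \<rho>)
  case 0
  then show ?case
    using exec_While_False[of x "Nonzero d" \<rho> h] by (simp add: fun_upd_idem)
next
  case (Suc n)
  show ?case
    by (rule exec_While_True[OF _ exec_Dec[OF refl]])
      (use Suc(1)[of "\<rho>(d := \<rho> d - 1)"] Suc(2,3) in auto)
qed

definition Copy :: "nat \<Rightarrow> nat \<Rightarrow> nat \<Rightarrow> com" where
  "Copy a b t = Loop a (Inc b ;; Inc t) ;; Loop t (Inc a)"

lemma exec_Copy:
  assumes "distinct [a, b, t]" "\<rho> b = 0" "\<rho> t = 0" "\<rho>' = \<rho>(b := \<rho> a)"
  shows "exec x (Copy a b t) (\<rho>, h, w) (\<rho>', h, w)"
  unfolding Copy_def
  by (rule exec_Seq[OF exec_transfer2[OF _ refl] exec_transfer])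
    (use assms in \<open>auto simp: fun_eq_iff\<close>)

abbreviation pfst :: "nat \<Rightarrow> nat" where "pfst n \<equiv> fst (prod_decode n)"
abbreviation psnd :: "nat \<Rightarrow> nat" where "psnd n \<equiv> snd (prod_decode n)"

text \<open>Starting at (0, 0), walks along the antidiagonals of the Cantor enumeration for as many
  steps as \<open>d\<close> says.\<close>

definition Unpair :: "nat \<Rightarrow> nat \<Rightarrow> nat \<Rightarrow> com" where
  "Unpair d a b = Loop d (Cond (Nonzero b) (Dec b ;; Inc a) (Loop a (Inc b) ;; Inc b))"

text \<open>One step of this walk: along the current antidiagonal, or to the start of the next
  one.\<close>

lemma prod_decode_Suc:
  "prod_decode (Suc n) =
     (case prod_decode n of (a, 0) \<Rightarrow> (0, Suc a) | (a, Suc b) \<Rightarrow> (Suc a, b))"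
proof -
  obtain a b where ab: "prod_decode n = (a, b)"
    by fastforce
  then have n: "n = prod_encode (a, b)"
    by (metis prod_decode_inverse)
  show ?thesis
    unfolding ab
  proof (cases b)
    case 0
    then have "Suc n = prod_encode (0, Suc a)"
      by (simp add: n prod_encode_def)
    then show "prod_decode (Suc n) =
        (case (a, b) of (a, 0) \<Rightarrow> (0, Suc a) | (a, Suc b) \<Rightarrow> (Suc a, b))"
      using 0 by simp
  next
    case (Suc b')
    then have "Suc n = prod_encode (Suc a, b')"
      by (simp add: n prod_encode_def)
    then show "prod_decode (Suc n) =
        (case (a, b) of (a, 0) \<Rightarrow> (0, Suc a) | (a, Suc b) \<Rightarrow> (Suc a, b))"
      using Suc by simp
  qed
qed

lemma exec_Unpair:
  assumes d: "distinct [d, a, b]" and z: "\<rho> a = 0" "\<rho> b = 0"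
    and \<rho>': "\<rho>' = \<rho>(d := 0, a := pfst (\<rho> d), b := psnd (\<rho> d))"
  shows "exec x (Unpair d a b) (\<rho>, h, w) (\<rho>', h, w)"
proof -
  let ?\<rho> = "\<lambda>j. \<rho>(a := pfst j, b := psnd j)"
  have "exec x (Cond (Nonzero b) (Dec b ;; Inc a) (Loop a (Inc b) ;; Inc b))
      ((?\<rho> j)(d := v), h, w) ((?\<rho> (Suc j))(d := v), h, w)" for j v
  proof (rule exec_Cond, cases "psnd j")
    case 0
    then show "exec x (if true_at x (Nonzero b) ((?\<rho> j)(d := v)) h
        then Dec b ;; Inc a else Loop a (Inc b) ;; Inc b)
        ((?\<rho> j)(d := v), h, w) ((?\<rho> (Suc j))(d := v), h, w)"
      using d
      by (auto intro!: exec_Seq[OF exec_transfer[OF _ refl]] exec_Inc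
          simp: prod_decode_Suc fun_eq_iff split: prod.split)
  next
    case (Suc b')
    then show "exec x (if true_at x (Nonzero b) ((?\<rho> j)(d := v)) h
        then Dec b ;; Inc a else Loop a (Inc b) ;; Inc b)
        ((?\<rho> j)(d := v), h, w) ((?\<rho> (Suc j))(d := v), h, w)"
      using d
      by (auto intro!: exec_Seq[OF exec_Dec[OF refl]] exec_Inc
          simp: prod_decode_Suc fun_eq_iff split: prod.split)
  qed
  from exec_Loop[where \<rho> = ?\<rho> and h = "\<lambda>_. h" and w = "\<lambda>_. w" and n = "\<rho> d", OF this]
  show ?thesis
    unfolding Unpair_def
    by (rule exec_eq) (use d z \<rho>' in \<open>auto simp: fun_eq_iff prod_decode_def prod_decode_aux.simps\<close>)
qed

text \<open>Uses \<open>prod_encode (a, b) = triangle (a + b) + a\<close>: the first loop puts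
  \<open>a\<close> into \<open>d\<close> and \<open>a + b\<close> into \<open>b\<close>; the rounds
  of the second add \<open>a + b\<close>, \<open>a + b - 1\<close>, ..., 1 to
  \<open>d\<close>.\<close>

definition Pair_up :: "nat \<Rightarrow> nat \<Rightarrow> nat \<Rightarrow> com" where
  "Pair_up d a b =
     Loop a (Inc b ;; Inc d) ;;
     While (Nonzero b) (Loop b (Inc a ;; Inc d) ;; Loop a (Inc b) ;; Dec b)"

lemma exec_Pair_up:
  assumes d: "distinct [d, a, b]" and z: "\<rho> d = 0"
    and \<rho>': "\<rho>' = \<rho>(d := prod_encode (\<rho> a, \<rho> b), a := 0, b := 0)"
  shows "exec x (Pair_up d a b) (\<rho>, h, w) (\<rho>', h, w)"
proof -
  have *: "exec x (While (Nonzero b) (Loop b (Inc a ;; Inc d) ;; Loop a (Inc b) ;; Dec b))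
      (\<rho>(a := 0, b := s, d := v), h, w) (\<rho>(a := 0, b := 0, d := v + triangle s), h, w)" for s v
  proof (induction s arbitrary: v)
    case 0
    then show ?case
      using d by (auto intro!: exec_While_False)
  next
    case (Suc s)
    show ?case
    proof (rule exec_While_True)
      show "exec x (Loop b (Inc a ;; Inc d) ;; Loop a (Inc b) ;; Dec b)
          (\<rho>(a := 0, b := Suc s, d := v), h, w) (\<rho>(a := 0, b := s, d := v + Suc s), h, w)"
        by (rule exec_Seq[OF exec_transfer2[OF _ refl] exec_Seq[OF exec_transfer[OF _ refl] exec_Dec]])
          (use d in \<open>auto simp: fun_eq_iff\<close>)
      show "exec x (While (Nonzero b) (Loop b (Inc a ;; Inc d) ;; Loop a (Inc b) ;; Dec b))
          (\<rho>(a := 0, b := s, d := v + Suc s), h, w)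
          (\<rho>(a := 0, b := 0, d := v + triangle (Suc s)), h, w)"
        by (rule exec_eq[OF Suc.IH[of "v + Suc s"]]) (auto simp: fun_eq_iff)
    qed (use d in auto)
  qed
  show ?thesis
    unfolding Pair_up_def
    by (rule exec_Seq[OF exec_transfer2[OF _ refl] exec_eq[OF *[of "\<rho> a + \<rho> b" "\<rho> a"]]])
      (use d z \<rho>' in \<open>auto simp: fun_eq_iff prod_encode_def\<close>)
qed

section \<open>Reading values of the input sequence\<close>

lemma length_unary_ge: "n \<le> length (unary p n)"
  by (induction n) (auto simp: unary_Suc)

lemma unary_mono: "m \<le> n \<Longrightarrow> prefix (unary p m) (unary p n)"
  by (induction rule: dec_induct) (auto simp: unary_Suc intro: prefix_order.trans)

text \<open>Of two unary words of one sequence the shorter is a prefix of the longer, so every word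
  that is long enough gives the same letter.\<close>

lemma input_cell_unary:
  assumes "i < length (unary p n)"
  shows "input_cell p (Suc i) = Some (unary p n ! i)"
proof -
  have "i < length (unary p (Suc i))"
    using length_unary_ge[of "Suc i" p] by simp
  then have "unary p (Suc i) ! i = unary p n ! i"
    using assms unary_mono[of n "Suc i" p] unary_mono[of "Suc i" n p]
    by (cases "n \<le> Suc i") (auto simp: prefix_def nth_append)
  then show ?thesis
    by simp
qed

lemma input_cell_Stroke: "j < p n \<Longrightarrow> input_cell p (Suc (length (unary p n) + j)) = Some Stroke"
  using input_cell_unary[of "length (unary p n) + j" p "Suc n"]
  by (simp add: unary_Suc nth_append del: input_cell.simps)

lemma input_cell_Sep: "input_cell p (Suc (length (unary p n) + p n)) = Some Sep"
  using input_cell_unary[of "length (unary p n) + p n" p "Suc n"]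
  by (simp add: unary_Suc nth_append del: input_cell.simps)

text \<open>Rewinds to the end marker, skips one block for each unit of \<open>d\<close>, and counts
  the strokes of the next block into \<open>d\<close>, which the skipping has cleared.\<close>

definition Query :: "nat \<Rightarrow> com" where
  "Query d = While (Cell False None) (Shift Leftward) ;; Shift Rightward ;;
     Loop d (While (Cell True (Some Stroke)) (Shift Rightward) ;; Shift Rightward) ;;
     While (Cell True (Some Stroke)) (Inc d ;; Shift Rightward)"

lemma exec_Query:
  assumes \<rho>': "\<rho>' = \<rho>(d := x (\<rho> d))"
  shows "\<exists>h'. exec x (Query d) (\<rho>, h, w) (\<rho>', h', w)"
proof -
  have rewind: "exec x (While (Cell False None) (Shift Leftward)) (\<rho>, h, w) (\<rho>, 0, w)"
  proof (induction h)
    case 0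
    then show ?case by (auto intro!: exec_While_False)
  next
    case (Suc h)
    show ?case by (rule exec_While_True[OF _ exec_Shift[OF refl]]) (use Suc in auto)
  qed
  let ?h = "\<lambda>j. Suc (length (unary x j))"
  have skip: "exec x (While (Cell True (Some Stroke)) (Shift Rightward))
      (\<rho>, ?h n + j, w) (\<rho>, ?h n + x n, w)" if "j \<le> x n" for \<rho> n j
    using that
  proof (induction j rule: inc_induct)
    case base
    then show ?case using input_cell_Sep[of x n] by (intro exec_While_False) auto
  next
    case (step j)
    show ?case
      by (rule exec_While_True[OF _ exec_Shift[OF refl]])
        (use step input_cell_Stroke[of j x n] in auto)
  qed
  have "exec x (While (Cell True (Some Stroke)) (Shift Rightward) ;; Shift Rightward)
      (\<rho>(d := v), ?h j, w) (\<rho>(d := v), ?h (Suc j), w)" for j v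
    using skip[of 0 j "\<rho>(d := v)"]
    by (intro exec_Seq[of _ _ _ "(\<rho>(d := v), ?h j + x j, w)"] exec_Shift)
      (auto simp: unary_Suc)
  from exec_Loop[where \<rho> = "\<lambda>_. \<rho>" and h = ?h and w = "\<lambda>_. w" and n = "\<rho> d", OF this]
  have find: "exec x (Loop d (While (Cell True (Some Stroke)) (Shift Rightward) ;; Shift Rightward))
      (\<rho>, 1, w) (\<rho>(d := 0), ?h (\<rho> d), w)"
    by (simp add: unary_def)
  have count: "exec x (While (Cell True (Some Stroke)) (Inc d ;; Shift Rightward))
      (\<rho>(d := j), ?h n + j, w) (\<rho>(d := x n), ?h n + x n, w)" if "j \<le> x n" for n j
    using that
  proof (induction j rule: inc_induct)
    case base
    then show ?case using input_cell_Sep[of x n] by (intro exec_While_False) auto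
  next
    case (step j)
    show ?case
    proof (rule exec_While_True)
      show "exec x (Inc d ;; Shift Rightward)
          (\<rho>(d := j), ?h n + j, w) (\<rho>(d := Suc j), ?h n + Suc j, w)"
        by (rule exec_Seq[OF exec_Inc exec_Shift]) auto
      show "exec x (While (Cell True (Some Stroke)) (Inc d ;; Shift Rightward))
          (\<rho>(d := Suc j), ?h n + Suc j, w) (\<rho>(d := x n), ?h n + x n, w)"
        by (rule step.IH)
    qed (use step input_cell_Stroke[of j x n] in auto)
  qed
  have "exec x (Query d) (\<rho>, h, w) (\<rho>', ?h (\<rho> d) + x (\<rho> d), w)"
    unfolding Query_def \<rho>'
    by (rule exec_Seq[OF rewind exec_Seq[OF exec_Shift[OF refl] exec_Seq]])
      (use find count[of 0 "\<rho> d"] in auto)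
  then show ?thesis ..
qed


section \<open>Primitive recursive functionals\<close>

text \<open>Several arguments are packed into the one number \<open>e\<close> by pairing. Iteration
  takes the place of the recursion scheme, which is derived as
  \<open>prim_rec_rec_nat\<close>.\<close>

inductive prim_rec :: "(baire \<Rightarrow> nat \<Rightarrow> nat) \<Rightarrow> bool" where
  zero: "prim_rec (\<lambda>x e. 0)"
| suc: "prim_rec (\<lambda>x e. Suc e)"
| first: "prim_rec (\<lambda>x e. pfst e)"
| second: "prim_rec (\<lambda>x e. psnd e)"
| query: "prim_rec (\<lambda>x e. x e)"
| pair: "prim_rec f \<Longrightarrow> prim_rec g \<Longrightarrow> prim_rec (\<lambda>x e. prod_encode (f x e, g x e))"
| comp: "prim_rec f \<Longrightarrow> prim_rec g \<Longrightarrow> prim_rec (\<lambda>x e. f x (g x e))"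
| iter: "prim_rec f \<Longrightarrow>
    prim_rec (\<lambda>x e. (f x ^^ psnd e) (pfst e))"

text \<open>Registers above d are scratch space, assumed to be zero initially and zero again at the end.\<close>

definition implements :: "com \<Rightarrow> nat \<Rightarrow> (baire \<Rightarrow> nat \<Rightarrow> nat) \<Rightarrow> bool" where
  "implements c d f \<longleftrightarrow> (\<forall>x \<rho> h w. (\<forall>r>d. \<rho> r = 0) \<longrightarrow>
     (\<exists>h'. exec x c (\<rho>, h, w) (\<rho>(d := f x (\<rho> d)), h', w)))"

lemma implementsD:
  assumes "implements c d f" "\<forall>r>d. \<rho> r = 0" "\<rho>' = \<rho>(d := f x (\<rho> d))"
  shows "\<exists>h'. exec x c (\<rho>, h, w) (\<rho>', h', w)"
  using assms unfolding implements_def by blast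

text \<open>The register \<open>d\<close> is arbitrary in the induction because subprograms work on
  higher registers, above intermediate results.\<close>

lemma prim_rec_implementable:
  assumes "prim_rec f"
  shows "\<exists>c. implements c d f"
  using assms
proof (induction f arbitrary: d rule: prim_rec.induct)
  case zero
  have "implements (Clear d) d (\<lambda>x e. 0)"
    unfolding implements_def using exec_Clear by blast
  then show ?case ..
next
  case suc
  have "implements (Inc d) d (\<lambda>x e. Suc e)"
    unfolding implements_def using exec_Inc by blast
  then show ?case ..
next
  case first
  have "implements (Unpair d (d + 1) (d + 2) ;; Loop (d + 1) (Inc d) ;; Clear (d + 2)) d
      (\<lambda>x e. pfst e)"
    unfolding implements_def
  proof (intro allI impI)
    fix x \<rho> h w
    assume "\<forall>r>d. \<rho> r = (0::nat)"
    then have "exec x (Unpair d (d + 1) (d + 2) ;; Loop (d + 1) (Inc d) ;; Clear (d + 2))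
        (\<rho>, h, w) (\<rho>(d := pfst (\<rho> d)), h, w)"
      by (intro exec_Seq[OF exec_Unpair[OF _ _ _ refl]]
          exec_Seq[OF exec_transfer[OF _ refl]] exec_Clear) (auto simp: fun_eq_iff)
    then show "\<exists>h'. exec x (Unpair d (d + 1) (d + 2) ;; Loop (d + 1) (Inc d) ;; Clear (d + 2))
        (\<rho>, h, w) (\<rho>(d := pfst (\<rho> d)), h', w)" ..
  qed
  then show ?case ..
next
  case second
  have "implements (Unpair d (d + 1) (d + 2) ;; Loop (d + 2) (Inc d) ;; Clear (d + 1)) d
      (\<lambda>x e. psnd e)"
    unfolding implements_def
  proof (intro allI impI)
    fix x \<rho> h w
    assume "\<forall>r>d. \<rho> r = (0::nat)"
    then have "exec x (Unpair d (d + 1) (d + 2) ;; Loop (d + 2) (Inc d) ;; Clear (d + 1))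
        (\<rho>, h, w) (\<rho>(d := psnd (\<rho> d)), h, w)"
      by (intro exec_Seq[OF exec_Unpair[OF _ _ _ refl]]
          exec_Seq[OF exec_transfer[OF _ refl]] exec_Clear) (auto simp: fun_eq_iff)
    then show "\<exists>h'. exec x (Unpair d (d + 1) (d + 2) ;; Loop (d + 2) (Inc d) ;; Clear (d + 1))
        (\<rho>, h, w) (\<rho>(d := psnd (\<rho> d)), h', w)" ..
  qed
  then show ?case ..
next
  case query
  have "implements (Query d) d (\<lambda>x e. x e)"
    unfolding implements_def using exec_Query by blast
  then show ?case ..
next
  case (pair f g)
  obtain c1 where c1: "implements c1 (d + 1) f" using pair.IH(1) by blast
  obtain c2 where c2: "implements c2 (d + 2) g" using pair.IH(2) by blast
  have "implements (Copy d (d + 1) (d + 2) ;; c1 ;; Copy d (d + 2) (d + 3) ;; c2 ;; Clear d ;;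
      Pair_up d (d + 1) (d + 2)) d (\<lambda>x e. prod_encode (f x e, g x e))"
    unfolding implements_def
  proof (intro allI impI)
    fix x \<rho> h w
    assume z: "\<forall>r>d. \<rho> r = (0::nat)"
    let ?e = "\<rho> d"
    have "\<exists>h1. exec x c1 (\<rho>(d + 1 := ?e), h, w) (\<rho>(d + 1 := f x ?e), h1, w)"
      by (rule implementsD[OF c1]) (use z in simp_all)
    then obtain h1 where 1: "exec x c1 (\<rho>(d + 1 := ?e), h, w) (\<rho>(d + 1 := f x ?e), h1, w)" ..
    have "\<exists>h2. exec x c2 (\<rho>(d + 1 := f x ?e, d + 2 := ?e), h1, w)
        (\<rho>(d + 1 := f x ?e, d + 2 := g x ?e), h2, w)"
      by (rule implementsD[OF c2]) (use z in simp_all)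
    then obtain h2 where 2: "exec x c2 (\<rho>(d + 1 := f x ?e, d + 2 := ?e), h1, w)
        (\<rho>(d + 1 := f x ?e, d + 2 := g x ?e), h2, w)" ..
    have "exec x (Copy d (d + 1) (d + 2) ;; c1 ;; Copy d (d + 2) (d + 3) ;; c2 ;; Clear d ;;
        Pair_up d (d + 1) (d + 2)) (\<rho>, h, w) (\<rho>(d := prod_encode (f x ?e, g x ?e)), h2, w)"
      by (rule exec_Seq[OF exec_Copy exec_Seq[OF 1 exec_Seq[OF exec_Copy exec_Seq[OF 2
              exec_Seq[OF exec_Clear[OF refl] exec_Pair_up]]]]])
        (use z in \<open>auto simp: fun_eq_iff\<close>)
    then show "\<exists>h'. exec x (Copy d (d + 1) (d + 2) ;; c1 ;; Copy d (d + 2) (d + 3) ;; c2 ;; Clear d ;;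
        Pair_up d (d + 1) (d + 2)) (\<rho>, h, w) (\<rho>(d := prod_encode (f x ?e, g x ?e)), h', w)" ..
  qed
  then show ?case ..
next
  case (comp f g)
  then obtain c1 c2 where c: "implements c1 d f" "implements c2 d g" by blast
  have "implements (c2 ;; c1) d (\<lambda>x e. f x (g x e))"
    unfolding implements_def
  proof (intro allI impI)
    fix x \<rho> h w
    assume z: "\<forall>r>d. \<rho> r = (0::nat)"
    obtain h1 where 1: "exec x c2 (\<rho>, h, w) (\<rho>(d := g x (\<rho> d)), h1, w)"
      using implementsD[OF c(2) z refl] by blast
    have "\<exists>h2. exec x c1 (\<rho>(d := g x (\<rho> d)), h1, w) (\<rho>(d := f x (g x (\<rho> d))), h2, w)"
      by (rule implementsD[OF c(1)]) (use z in simp_all)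
    then obtain h2 where 2: "exec x c1 (\<rho>(d := g x (\<rho> d)), h1, w) (\<rho>(d := f x (g x (\<rho> d))), h2, w)" ..
    show "\<exists>h'. exec x (c2 ;; c1) (\<rho>, h, w) (\<rho>(d := f x (g x (\<rho> d))), h', w)"
      using exec_Seq[OF 1 2] ..
  qed
  then show ?case ..
next
  case (iter f)
  then obtain c where c: "implements c (d + 1) f"
    by blast
  \<comment> \<open>The count is moved from \<open>d + 2\<close> down to \<open>d\<close>, since
    \<open>c\<close> needs all registers above \<open>d + 1\<close> to be zero.\<close>
  let ?c = "Unpair d (d + 1) (d + 2) ;; Loop (d + 2) (Inc d) ;; Loop d c ;; Loop (d + 1) (Inc d)"
  have "implements ?c d (\<lambda>x e. (f x ^^ psnd e) (pfst e))"
    unfolding implements_def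
  proof (intro allI impI)
    fix x \<rho> h w
    assume z: "\<forall>r>d. \<rho> r = (0::nat)"
    define a where "a = pfst (\<rho> d)"
    define n where "n = psnd (\<rho> d)"
    define \<sigma> where "\<sigma> j = \<rho>(d + 1 := (f x ^^ j) a)" for j
    have "\<exists>h'. exec x c ((\<sigma> j)(d := v), h, w) ((\<sigma> (Suc j))(d := v), h', w)" for j v h
      by (rule implementsD[OF c]) (use z in \<open>simp_all add: \<sigma>_def fun_eq_iff\<close>)
    from exec_Loop_any_head[of x c \<sigma> d w, OF this]
    obtain h' where h': "exec x (Loop d c) ((\<sigma> 0)(d := n), h, w) ((\<sigma> n)(d := 0), h', w)"
      by blast
    have "exec x ?c (\<rho>, h, w) (\<rho>(d := (f x ^^ n) a), h', w)"
      by (rule exec_Seq[OF exec_Unpair[OF _ _ _ refl]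
            exec_Seq[OF exec_transfer exec_Seq[OF h' exec_transfer]]])
        (use z in \<open>auto simp: fun_eq_iff \<sigma>_def a_def n_def\<close>)
    then show "\<exists>h'. exec x ?c (\<rho>, h, w)
        (\<rho>(d := (f x ^^ psnd (\<rho> d)) (pfst (\<rho> d))), h', w)"
      unfolding a_def n_def ..
  qed
  then show ?case ..
qed

section \<open>Closure properties of primitive recursive functionals\<close>

lemma prim_rec_id: "prim_rec (\<lambda>x e. e)"
  using prim_rec.pair[OF prim_rec.first prim_rec.second] by simp

lemma prim_rec_const: "prim_rec (\<lambda>x e. n)"
  by (induction n) (auto intro: prim_rec.zero prim_rec.comp[OF prim_rec.suc])

lemma prim_rec_Suc: "prim_rec a \<Longrightarrow> prim_rec (\<lambda>x e. Suc (a x e))"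
  by (rule prim_rec.comp[OF prim_rec.suc])

lemma prim_rec_fst: "prim_rec a \<Longrightarrow> prim_rec (\<lambda>x e. pfst (a x e))"
  by (rule prim_rec.comp[OF prim_rec.first])

lemma prim_rec_snd: "prim_rec a \<Longrightarrow> prim_rec (\<lambda>x e. psnd (a x e))"
  by (rule prim_rec.comp[OF prim_rec.second])

lemma prim_rec_query: "prim_rec a \<Longrightarrow> prim_rec (\<lambda>x e. x (a x e))"
  by (rule prim_rec.comp[OF prim_rec.query])

text \<open>\<open>iter\<close> passes no parameter to its step, so \<open>e\<close> travels along
  as the second component of the iterated pair.\<close>

lemma prim_rec_funpow:
  assumes "prim_rec a" "prim_rec b"
    and f: "prim_rec (\<lambda>x e. f x (pfst e) (psnd e))"
  shows "prim_rec (\<lambda>x e. ((\<lambda>y. f x y e) ^^ b x e) (a x e))"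
proof -
  define g where "g x p = prod_encode (f x (pfst p) (psnd p),
    psnd p)" for x p
  have "prim_rec g"
    unfolding g_def by (intro prim_rec.pair f prim_rec.second)
  then have "prim_rec (\<lambda>x e. (g x ^^ b x e) (prod_encode (a x e, e)))"
    using prim_rec.comp[OF prim_rec.iter[of g]
        prim_rec.pair[OF prim_rec.pair[OF assms(1) prim_rec_id] assms(2)]] by simp
  moreover have "(g x ^^ n) (prod_encode (y, e)) = prod_encode (((\<lambda>y. f x y e) ^^ n) y, e)"
    for x n y e
    by (induction n) (auto simp: g_def)
  ultimately show ?thesis
    using prim_rec_fst by fastforce
qed

text \<open>The iterated object is a pair of round number and value; the step receives the round
  number as \<open>i\<close>.\<close>

lemma prim_rec_rec_nat:
  assumes "prim_rec a" "prim_rec b"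
    and f: "prim_rec (\<lambda>x e. f x (pfst (pfst e))
      (psnd (pfst e)) (psnd e))"
  shows "prim_rec (\<lambda>x e. rec_nat (a x e) (\<lambda>i y. f x i y e) (b x e))"
proof -
  define g where "g x p e = prod_encode (Suc (pfst p),
    f x (pfst p) (psnd p) e)" for x p e
  have "prim_rec (\<lambda>x e. ((\<lambda>p. g x p e) ^^ b x e) (prod_encode (0, a x e)))"
    unfolding g_def
    by (intro prim_rec_funpow prim_rec.pair prim_rec_Suc prim_rec_fst prim_rec_const prim_rec_id f assms)
  moreover have "((\<lambda>p. g x p e) ^^ n) (prod_encode (0, y)) = prod_encode (n, rec_nat y (\<lambda>i y. f x i y e) n)"
    for x n y e
    by (induction n) (auto simp: g_def)
  ultimately show ?thesis
    using prim_rec_snd by fastforce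
qed

lemma prim_rec_add: "prim_rec a \<Longrightarrow> prim_rec b \<Longrightarrow> prim_rec (\<lambda>x e. a x e + b x e)"
proof -
  assume "prim_rec a" "prim_rec b"
  then have "prim_rec (\<lambda>x e. (Suc ^^ b x e) (a x e))"
    by (intro prim_rec_funpow prim_rec_Suc prim_rec_fst prim_rec_id)
  then show ?thesis
    by (simp add: add.commute)
qed

lemma prim_rec_diff: "prim_rec a \<Longrightarrow> prim_rec b \<Longrightarrow> prim_rec (\<lambda>x e. a x e - b x e)"
proof -
  assume ab: "prim_rec a" "prim_rec b"
  \<comment> \<open>A recursion that returns its index and forgets the previous value is the
    predecessor.\<close>
  have "rec_nat 0 (\<lambda>i y. i) n = n - 1" for n :: nat
    by (cases n) auto
  then have pred: "prim_rec (\<lambda>x e. c x e - 1)" if "prim_rec c" for c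
    using prim_rec_rec_nat[of "\<lambda>x e. 0" c "\<lambda>x i y e. i"] that
    by (simp add: prim_rec_fst prim_rec_id prim_rec_const)
  have "prim_rec (\<lambda>x e. ((\<lambda>y. y - 1) ^^ b x e) (a x e))"
    by (intro prim_rec_funpow pred ab prim_rec_fst prim_rec_id)
  moreover have "((\<lambda>y. y - 1) ^^ n) m = m - n" for m n :: nat
    by (induction n) auto
  ultimately show ?thesis
    by simp
qed

abbreviation prim_rec_pred :: "(baire \<Rightarrow> nat \<Rightarrow> bool) \<Rightarrow> bool" where
  "prim_rec_pred P \<equiv> prim_rec (\<lambda>x e. of_bool (P x e))"

text \<open>A case distinction is a recursion of length 0 or 1 on the truth value.\<close>

lemma prim_rec_if:
  assumes "prim_rec_pred P" "prim_rec a" "prim_rec b"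
  shows "prim_rec (\<lambda>x e. if P x e then a x e else b x e)"
proof -
  have "prim_rec (\<lambda>x e. rec_nat (b x e) (\<lambda>_ _. a x e) (of_bool (P x e)))"
    by (intro prim_rec_rec_nat assms prim_rec.comp[OF assms(2)] prim_rec_snd prim_rec_id)
  moreover have "rec_nat v (\<lambda>_ _. u) (of_bool B) = (if B then u else v)" for u v :: nat and B
    by (cases B) auto
  ultimately show ?thesis
    by simp
qed

lemma prim_rec_pred_eq0: "prim_rec a \<Longrightarrow> prim_rec_pred (\<lambda>x e. a x e = 0)"
  using prim_rec_diff[OF prim_rec_const[of 1], of a]
  by (rule back_subst[of prim_rec]) (auto simp: fun_eq_iff)

lemma prim_rec_pred_le:
  "prim_rec a \<Longrightarrow> prim_rec b \<Longrightarrow> prim_rec_pred (\<lambda>x e. a x e \<le> b x e)"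
  using prim_rec_pred_eq0[OF prim_rec_diff[of a b]] by simp

lemma prim_rec_pred_less:
  "prim_rec a \<Longrightarrow> prim_rec b \<Longrightarrow> prim_rec_pred (\<lambda>x e. a x e < b x e)"
  using prim_rec_pred_le[OF prim_rec_Suc[of a]] by (simp add: Suc_le_eq)

lemma prim_rec_pred_not: "prim_rec_pred P \<Longrightarrow> prim_rec_pred (\<lambda>x e. \<not> P x e)"
  using prim_rec_pred_eq0[of "\<lambda>x e. of_bool (P x e)"] by simp

lemma prim_rec_pred_conj:
  "prim_rec_pred P \<Longrightarrow> prim_rec_pred Q \<Longrightarrow> prim_rec_pred (\<lambda>x e. P x e \<and> Q x e)"
  using prim_rec_if[of P "\<lambda>x e. of_bool (Q x e)" "\<lambda>x e. 0", OF _ _ prim_rec_const]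
  by (rule back_subst[of prim_rec]) (auto simp: fun_eq_iff)

lemma prim_rec_pred_eq:
  "prim_rec a \<Longrightarrow> prim_rec b \<Longrightarrow> prim_rec_pred (\<lambda>x e. a x e = b x e)"
  using prim_rec_pred_conj[OF prim_rec_pred_le[of a b] prim_rec_pred_le[of b a]]
  by (simp add: eq_iff)

lemma prim_rec_pred_bex:
  assumes "prim_rec b"
    and "prim_rec_pred (\<lambda>x e. P x (pfst e) (psnd e))"
  shows "prim_rec_pred (\<lambda>x e. \<exists>i<b x e. P x i e)"
proof -
  have P: "prim_rec_pred (\<lambda>x e. P x (a x e) (c x e))" if "prim_rec a" "prim_rec c" for a c
    using prim_rec.comp[OF assms(2) prim_rec.pair[OF that]] by simp
  have *: "rec_nat 0 (\<lambda>i y. if P x i e then 1 else y) n = of_bool (\<exists>i<n. P x i e)" for x e n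
    by (induction n) (auto simp: less_Suc_eq)
  show ?thesis
    unfolding *[symmetric] by (intro prim_rec_rec_nat prim_rec_const assms(1) prim_rec_if P
        prim_rec_fst prim_rec_snd prim_rec_id)
qed

lemmas prim_rec_intros = prim_rec_id prim_rec_const prim_rec_Suc prim_rec_fst prim_rec_snd
  prim_rec.pair prim_rec_query prim_rec_add prim_rec_diff prim_rec_if prim_rec_pred_le
  prim_rec_pred_less prim_rec_pred_not prim_rec_pred_conj prim_rec_pred_eq prim_rec_pred_bex

lemma prim_rec_div2: "prim_rec a \<Longrightarrow> prim_rec (\<lambda>x e. a x e div 2)"
  and prim_rec_pred_even: "prim_rec a \<Longrightarrow> prim_rec_pred (\<lambda>x e. even (a x e))"
proof -
  assume a: "prim_rec a"
  \<comment> \<open>Counting up, \<open>y\<close> is half of \<open>i\<close> rounded down and has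
    to grow exactly when \<open>i\<close> is odd, that is, when \<open>y + y < i\<close>.\<close>
  have *: "rec_nat 0 (\<lambda>i y. if y + y < i then Suc y else y) n = n div 2" for n :: nat
    by (induction n) auto
  have **: "prim_rec (\<lambda>x e. a x e div 2)" if "prim_rec a" for a
    unfolding *[symmetric] by (intro prim_rec_rec_nat prim_rec_intros that)
  then show "prim_rec (\<lambda>x e. a x e div 2)"
    using a .
  have "prim_rec_pred (\<lambda>x e. a x e = a x e div 2 + a x e div 2)"
    by (intro prim_rec_intros ** a)
  moreover have "n = n div 2 + n div 2 \<longleftrightarrow> even n" for n :: nat
    by presburger
  ultimately show "prim_rec_pred (\<lambda>x e. even (a x e))"
    by simp
qed


section \<open>Unbounded search\<close>

text \<open>The value 0 of \<open>g\<close> means that the search goes on, \<open>Suc v\<close> that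
  the next output is \<open>v\<close>. The machine keeps the pair of output index and search index
  in register 0 and never stops. The condition is imposed on each input separately, so partial
  functions are covered.\<close>

lemma ex_tm_search:
  assumes g: "prim_rec g"
  shows "\<exists>M. turing_machine M \<and> (\<forall>x r. (\<forall>n. \<exists>j. g x (prod_encode (n, j)) = Suc (r n) \<and>
      (\<forall>i<j. g x (prod_encode (n, i)) = 0)) \<longrightarrow> tm_fun M x = Some r)"
proof -
  define f where "f x e = (if g x e = 0
      then prod_encode (pfst e, Suc (psnd e))
      else prod_encode (Suc (pfst e), 0))" for x e
  have "prim_rec f"
    unfolding f_def by (intro prim_rec_intros g)
  then obtain c2 where c2: "implements c2 0 f"
    using prim_rec_implementable by blast
  obtain c1 where c1: "implements c1 1 g"
    using prim_rec_implementable g by blast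
  \<comment> \<open>\<open>Shift Stay\<close> is the idle command. Register 1 holds
    \<open>g x e\<close>, and \<open>Dec 1\<close> turns \<open>Suc v\<close> into the number of
    strokes to be written.\<close>
  define body where "body = Copy 0 1 2 ;; c1 ;;
    Cond (Nonzero 1) (Dec 1 ;; Loop 1 (Out Stroke) ;; Out Sep) (Shift Stay) ;; c2"
  define main where "main = While Always body"
  define \<sigma> :: "nat \<Rightarrow> nat \<Rightarrow> nat" where "\<sigma> e = (\<lambda>_. 0)(0 := e)" for e
  have body: "\<exists>h'. exec x body (\<sigma> e, h, w) (\<sigma> (f x e), h',
      w @ (if g x e = 0 then [] else replicate (g x e - 1) Stroke @ [Sep]))" (is "\<exists>h'. exec _ _ _ (_, _, ?w)")
    for x e h w
  proof -
    have "\<exists>h1. exec x c1 ((\<sigma> e)(1 := e), h, w) ((\<sigma> e)(1 := g x e), h1, w)"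
      by (rule implementsD[OF c1]) (simp_all add: \<sigma>_def)
    then obtain h1 where 1: "exec x c1 ((\<sigma> e)(1 := e), h, w) ((\<sigma> e)(1 := g x e), h1, w)" ..
    have "\<exists>h2. exec x c2 (\<sigma> e, h1, ?w) (\<sigma> (f x e), h2, ?w)"
      by (rule implementsD[OF c2]) (simp_all add: \<sigma>_def)
    then obtain h2 where 2: "exec x c2 (\<sigma> e, h1, ?w) (\<sigma> (f x e), h2, ?w)" ..
    have loop: "exec x (Loop 1 (Out Stroke)) ((\<sigma> e)(1 := v), h1, w)
        (\<sigma> e, h1, w @ replicate v Stroke)" for v
      by (rule exec_eq[OF exec_Loop[of v x _ "\<lambda>_. \<sigma> e" _ "\<lambda>_. h1" "\<lambda>j. w @ replicate j Stroke"]])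
        (auto simp: \<sigma>_def fun_eq_iff replicate_append_same[symmetric]
          intro!: exec_eq[OF exec_Out])
    have "exec x (Cond (Nonzero 1) (Dec 1 ;; Loop 1 (Out Stroke) ;; Out Sep) (Shift Stay))
        ((\<sigma> e)(1 := g x e), h1, w) (\<sigma> e, h1, ?w)"
    proof (rule exec_Cond, cases "g x e")
      case 0
      then have "(\<sigma> e)(1 := g x e) = \<sigma> e"
        by (auto simp: \<sigma>_def)
      then show "exec x (if true_at x (Nonzero 1) ((\<sigma> e)(1 := g x e)) h1
          then Dec 1 ;; Loop 1 (Out Stroke) ;; Out Sep else Shift Stay)
          ((\<sigma> e)(1 := g x e), h1, w) (\<sigma> e, h1, ?w)"
        using 0 by (simp add: \<sigma>_def exec_Shift)
    next
      case (Suc v)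
      have "exec x (Dec 1 ;; Loop 1 (Out Stroke) ;; Out Sep) ((\<sigma> e)(1 := g x e), h1, w)
          (\<sigma> e, h1, (w @ replicate v Stroke) @ [Sep])"
        by (rule exec_Seq[OF exec_Dec exec_Seq[OF loop[of v] exec_Out]]) (simp add: Suc)
      then show "exec x (if true_at x (Nonzero 1) ((\<sigma> e)(1 := g x e)) h1
          then Dec 1 ;; Loop 1 (Out Stroke) ;; Out Sep else Shift Stay)
          ((\<sigma> e)(1 := g x e), h1, w) (\<sigma> e, h1, ?w)"
        using Suc by simp
    qed
    from exec_Seq[OF exec_Copy exec_Seq[OF 1 exec_Seq[OF this 2]]]
    have "exec x body (\<sigma> e, h, w) (\<sigma> (f x e), h2, ?w)"
      unfolding body_def by (simp add: \<sigma>_def)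
    then show ?thesis ..
  qed
  have round: "\<exists>h'. reaches x ([main], \<sigma> e, h, w) ([main], \<sigma> (f x e), h',
      w @ (if g x e = 0 then [] else replicate (g x e - 1) Stroke @ [Sep]))" for x e h w
  proof -
    have "reaches x ([main], \<sigma> e, h, w) ([body, main], \<sigma> e, h, w)"
      unfolding main_def by (rule reaches_step) simp
    then show ?thesis
      using body[of x e h w] unfolding exec_iff_reaches by (meson reaches_trans)
  qed
  have reach: "\<exists>h. reaches x ([main], \<lambda>_. 0, 0, []) ([main], \<sigma> (prod_encode (n, 0)), h, unary r n)"
    if r: "\<And>n. \<exists>j. g x (prod_encode (n, j)) = Suc (r n) \<and> (\<forall>i<j. g x (prod_encode (n, i)) = 0)"
    for x r n
  proof (induction n)
    case 0
    \<comment> \<open>The all-zero store is already the search state for output 0, as the pair (0,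
      0) has code 0.\<close>
    have "\<sigma> (prod_encode (0, 0)) = (\<lambda>_. 0)"
      by (simp add: \<sigma>_def prod_encode_def fun_eq_iff)
    then show ?case
      by (auto simp: unary_def intro: exI[of _ 0])
  next
    case (Suc n)
    obtain j where j: "g x (prod_encode (n, j)) = Suc (r n)" "\<And>i. i < j \<Longrightarrow> g x (prod_encode (n, i)) = 0"
      using r by blast
    have "\<exists>h. reaches x ([main], \<lambda>_. 0, 0, []) ([main], \<sigma> (prod_encode (n, i)), h, unary r n)"
      if "i \<le> j" for i
      using that
    proof (induction i)
      case (Suc i)
      then obtain h where
        "reaches x ([main], \<lambda>_. 0, 0, []) ([main], \<sigma> (prod_encode (n, i)), h, unary r n)"
        by auto
      moreover obtain h' where "reaches x ([main], \<sigma> (prod_encode (n, i)), h, unary r n)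
          ([main], \<sigma> (prod_encode (n, Suc i)), h', unary r n)"
        using round[of x "prod_encode (n, i)" h "unary r n"] j(2)[of i] Suc.prems
        by (auto simp: f_def)
      ultimately show ?case
        by (meson reaches_trans)
    qed (use Suc.IH in simp)
    then obtain h where
      "reaches x ([main], \<lambda>_. 0, 0, []) ([main], \<sigma> (prod_encode (n, j)), h, unary r n)"
      by auto
    moreover obtain h' where "reaches x ([main], \<sigma> (prod_encode (n, j)), h, unary r n)
        ([main], \<sigma> (prod_encode (Suc n, 0)), h', unary r (Suc n))"
      using round[of x "prod_encode (n, j)" h "unary r n"] j(1)
      by (auto simp: f_def unary_Suc)
    ultimately show ?case
      by (meson reaches_trans)
  qed
  obtain M where M: "turing_machine M" and sim: "\<And>x t. \<exists>T. output_after M x T =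
      snd (snd (snd ((com_step x ^^ t) ([main], \<lambda>_. 0, 0, []))))"
    using ex_tm_simulating by blast
  have "tm_fun M x = Some r"
    if r: "\<forall>n. \<exists>j. g x (prod_encode (n, j)) = Suc (r n) \<and> (\<forall>i<j. g x (prod_encode (n, i)) = 0)"
    for x r
  proof -
    have "produces M x r"
      unfolding produces_def
    proof
      fix n
      obtain h t where "(com_step x ^^ t) ([main], \<lambda>_. 0, 0, []) =
          ([main], \<sigma> (prod_encode (n, 0)), h, unary r n)"
        using reach r unfolding reaches_def by meson
      then obtain T where "output_after M x T = unary r n"
        using sim[of x t] by auto
      then show "\<exists>t. prefix (unary r n) (output_after M x t)"
        by (intro exI[of _ T]) simp
    qed
    then show ?thesis
      unfolding tm_fun_def by (auto intro: produces_unique the_equality)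
  qed
  then show ?thesis
    using M by blast
qed

lemma computable_prim_rec:
  assumes "prim_rec g"
  shows "computable (\<lambda>x. Some (g x))"
proof -
  \<comment> \<open>This value does not depend on the search index, so each search succeeds at its
    first try.\<close>
  have "prim_rec (\<lambda>x e. Suc (g x (pfst e)))"
    by (intro prim_rec_intros prim_rec.comp[OF assms])
  from ex_tm_search[OF this] obtain M where "turing_machine M" "\<And>x. tm_fun M x = Some (g x)"
    by auto
  then show ?thesis
    unfolding computable_def by auto
qed

section \<open>Simulation of a Turing machine\<close>

fun letter_code :: "letter option \<Rightarrow> nat" where
  "letter_code None = 0"
| "letter_code (Some Stroke) = 1"
| "letter_code (Some Sep) = 2"

lemma letter_code_eq_iff: "letter_code a = letter_code b \<longleftrightarrow> a = b"
  by (cases a rule: letter_code.cases; cases b rule: letter_code.cases) auto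

text \<open>The block that contains the i-th letter of the unary word, and the number of strokes of this
  block from that letter on.\<close>

definition block_at :: "baire \<Rightarrow> nat \<Rightarrow> nat" where
  "block_at z i =
     ((\<lambda>p. if psnd p = 0 then prod_encode (Suc (pfst p), z (Suc (pfst p)))
           else prod_encode (pfst p, psnd p - 1)) ^^ i) (prod_encode (0, z 0))"

definition cell_code :: "baire \<Rightarrow> nat \<Rightarrow> nat" where
  "cell_code z h = (if h = 0 then 0 else if psnd (block_at z (h - 1)) = 0 then 2 else 1)"

lemma block_at:
  "\<exists>n j. j \<le> z n \<and> i = length (unary z n) + j \<and> block_at z i = prod_encode (n, z n - j)"
proof (induction i)
  case 0
  then show ?case
    by (intro exI[of _ 0]) (auto simp: block_at_def unary_def)
next
  case (Suc i)
  then obtain n j where *: "j \<le> z n" "i = length (unary z n) + j"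
    "block_at z i = prod_encode (n, z n - j)"
    by blast
  show ?case
  proof (cases "j = z n")
    case True
    then show ?thesis
      using * by (intro exI[of _ "Suc n"] exI[of _ 0]) (auto simp: block_at_def unary_Suc)
  next
    case False
    then show ?thesis
      using * by (intro exI[of _ n] exI[of _ "Suc j"]) (auto simp: block_at_def)
  qed
qed

lemma cell_code: "cell_code z h = letter_code (input_cell z h)"
proof (cases h)
  case (Suc i)
  obtain n j where "j \<le> z n" "i = length (unary z n) + j" "block_at z i = prod_encode (n, z n - j)"
    using block_at by blast
  then show ?thesis
    using input_cell_Sep[of z n] input_cell_Stroke[of j z n] Suc
    by (cases "j = z n") (auto simp: cell_code_def simp del: input_cell.simps)
qed (simp add: cell_code_def)

lemma prim_rec_subst:
  assumes "prim_rec (\<lambda>x e. f x (pfst e) (psnd e))" "prim_rec a" "prim_rec b"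
  shows "prim_rec (\<lambda>x e. f x (a x e) (b x e))"
  using prim_rec.comp[OF assms(1) prim_rec.pair[OF assms(2,3)]] by simp

text \<open>The sequence \<open>z\<close> may depend on \<open>e\<close>, because later the
  simulated machine receives an input that changes with the stage.\<close>

lemma prim_rec_cell_code:
  assumes z: "prim_rec (\<lambda>x e. z x (pfst e) (psnd e))" and a: "prim_rec a"
  shows "prim_rec (\<lambda>x e. cell_code (\<lambda>i. z x i e) (a x e))"
  unfolding cell_code_def block_at_def
  by (intro prim_rec_intros prim_rec_funpow prim_rec_subst[OF z] a)

text \<open>A number codes a sequence of symbols, almost all 0; a tape is coded by the sequence to the left
  of the head, read leftwards, and the sequence that begins at the head.\<close>

definition symbols :: "nat \<Rightarrow> nat \<Rightarrow> nat" where
  "symbols c i = pfst ((psnd ^^ i) c)"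

lemma symbols_0: "symbols c 0 = pfst c"
  by (simp add: symbols_def)

lemma symbols_Suc: "symbols c (Suc i) = symbols (psnd c) i"
  by (simp add: symbols_def funpow_Suc_right del: funpow.simps)

lemma prod_decode_0 [simp]: "prod_decode 0 = (0, 0)"
  by (simp add: prod_decode_def prod_decode_aux.simps)

text \<open>Since 0 decodes to (0, 0), it codes the sequence of blanks; this makes 0 the code of a
  blank tape as well.\<close>

lemma symbols_zero [simp]: "symbols 0 i = 0"
  by (induction i) (auto simp: symbols_0 symbols_Suc)

definition codes_tape :: "nat \<Rightarrow> (int \<Rightarrow> nat) \<times> int \<Rightarrow> bool" where
  "codes_tape c = (\<lambda>(t, h). \<forall>i. t (h + int i) = symbols (psnd c) i \<and>
     t (h - 1 - int i) = symbols (pfst c) i)"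

fun tape_action :: "nat \<times> move \<Rightarrow> nat \<Rightarrow> nat" where
  "tape_action (y, Stay) c = prod_encode (pfst c, prod_encode (y, psnd (psnd c)))"
| "tape_action (y, Rightward) c = prod_encode (prod_encode (y, pfst c), psnd (psnd c))"
| "tape_action (y, Leftward) c = prod_encode (psnd (pfst c),
     prod_encode (pfst (pfst c), prod_encode (y, psnd (psnd c))))"

lemma codes_tape_action:
  assumes "codes_tape c T"
  shows "codes_tape (tape_action (y, m) c) (update_tape T (y, m))"
proof -
  obtain t h where T: "T = (t, h)"
    by fastforce
  have r: "t (h + int i) = symbols (psnd c) i" and l: "t (h - 1 - int i) = symbols (pfst c) i" for i
    using assms by (auto simp: codes_tape_def T)
  show ?thesis
    unfolding T codes_tape_def update_tape.simps prod.case
  proof (intro allI, cases m)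
    fix i
    case Stay
    then show "(t(h := y)) (move_work m h + int i) = symbols (psnd (tape_action (y, m) c)) i \<and>
        (t(h := y)) (move_work m h - 1 - int i) = symbols (pfst (tape_action (y, m) c)) i"
      using r[of i] l[of i] by (cases i) (auto simp: symbols_0 symbols_Suc)
  next
    fix i
    case Rightward
    then show "(t(h := y)) (move_work m h + int i) = symbols (psnd (tape_action (y, m) c)) i \<and>
        (t(h := y)) (move_work m h - 1 - int i) = symbols (pfst (tape_action (y, m) c)) i"
      using r[of "Suc i"] l[of "i - 1"]
      by (cases i) (auto simp: symbols_0 symbols_Suc algebra_simps)
  next
    fix i
    case Leftward
    then show "(t(h := y)) (move_work m h + int i) = symbols (psnd (tape_action (y, m) c)) i \<and>
        (t(h := y)) (move_work m h - 1 - int i) = symbols (pfst (tape_action (y, m) c)) i"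
      using r[of "i - 1"] l[of 0] l[of "Suc i"]
      by (cases i rule: nat.exhaust; cases "i - 1")
        (auto simp: symbols_0 symbols_Suc algebra_simps)
  qed
qed

lemma prim_rec_tape_action: "prim_rec c \<Longrightarrow> prim_rec (\<lambda>x e. tape_action a (c x e))"
  by (cases "(a, 0::nat)" rule: tape_action.cases) (auto intro!: prim_rec_intros)

fun codes_tapes :: "nat \<Rightarrow> ((int \<Rightarrow> nat) \<times> int) list \<Rightarrow> bool" where
  "codes_tapes c [] = True"
| "codes_tapes c (T # Ts) = (codes_tape (pfst c) T \<and> codes_tapes (psnd c) Ts)"

lemma codes_tapes_blank: "codes_tapes 0 (replicate n (\<lambda>_. 0, 0))"
  by (induction n) (auto simp: codes_tape_def)

fun scans :: "nat list \<Rightarrow> nat \<Rightarrow> bool" where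
  "scans [] c = True"
| "scans (x # xs) c = (pfst (psnd (pfst c)) = x \<and> scans xs (psnd c))"

lemma scans_iff:
  "codes_tapes c Ts \<Longrightarrow> length xs = length Ts \<Longrightarrow> scans xs c \<longleftrightarrow> map (\<lambda>(t, h). t h) Ts = xs"
proof (induction xs c arbitrary: Ts rule: scans.induct)
  case (2 x xs c)
  then obtain t h Ts' where "Ts = (t, h) # Ts'"
    by (cases Ts) auto
  moreover have "codes_tape c (t, h) \<Longrightarrow> t h = pfst (psnd c)" for c
    unfolding codes_tape_def by (auto dest!: spec[of _ 0] simp: symbols_0)
  ultimately show ?case
    using 2 by auto
qed simp

lemma prim_rec_scans: "prim_rec c \<Longrightarrow> prim_rec_pred (\<lambda>x e. scans xs (c x e))"
  by (induction xs arbitrary: c) (auto intro!: prim_rec_intros prim_rec_const[of 1, simplified])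

fun tapes_action :: "(nat \<times> move) list \<Rightarrow> nat \<Rightarrow> nat" where
  "tapes_action [] c = c"
| "tapes_action (y # ys) c = prod_encode (tape_action y (pfst c), tapes_action ys (psnd c))"

lemma codes_tapes_action:
  "codes_tapes c Ts \<Longrightarrow> length ys = length Ts \<Longrightarrow>
     codes_tapes (tapes_action ys c) (map2 update_tape Ts ys)"
proof (induction ys c arbitrary: Ts rule: tapes_action.induct)
  case (2 y ys c)
  then obtain T Ts' where "Ts = T # Ts'"
    by (cases Ts) auto
  then show ?case
    using 2 by (cases y) (auto intro: codes_tape_action)
qed simp

lemma prim_rec_tapes_action: "prim_rec c \<Longrightarrow> prim_rec (\<lambda>x e. tapes_action ys (c x e))"
  by (induction ys arbitrary: c) (auto intro!: prim_rec_intros prim_rec_tape_action)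

text \<open>The code of a configuration records, instead of the output, the number of separators written
  and whether the last step wrote a stroke.\<close>

abbreviation config_code :: "nat \<Rightarrow> nat \<Rightarrow> nat \<Rightarrow> nat \<Rightarrow> nat \<Rightarrow> nat" where
  "config_code q h w n b \<equiv> prod_encode (q, prod_encode (h, prod_encode (w, prod_encode (n, b))))"

abbreviation "code_state c \<equiv> pfst c"
abbreviation "code_head c \<equiv> pfst (psnd c)"
abbreviation "code_work c \<equiv> pfst (psnd (psnd c))"
abbreviation "code_seps c \<equiv> pfst (psnd (psnd (psnd c)))"
abbreviation "code_stroke c \<equiv> psnd (psnd (psnd (psnd c)))"

fun rule_action :: "action \<Rightarrow> nat \<Rightarrow> nat" where
  "rule_action (q, m, ys, b) c = config_code q (move_in m (code_head c))
     (tapes_action ys (code_work c)) (code_seps c + of_bool (b = Some Sep)) (of_bool (b = Some Stroke))"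

text \<open>Mirrors the lookup by \<open>map_of\<close> on codes. If no rule applies, only the
  stroke flag is cleared, as nothing is written.\<close>

fun rules_action :: "(situation \<times> action) list \<Rightarrow> nat \<Rightarrow> nat \<Rightarrow> nat" where
  "rules_action [] a c = config_code (code_state c) (code_head c) (code_work c) (code_seps c) 0"
| "rules_action (((q, a', xs), act) # rs) a c =
     (if code_state c = q \<and> a = letter_code a' \<and> scans xs (code_work c)
      then rule_action act c else rules_action rs a c)"

lemma prim_rec_rule_action: "prim_rec c \<Longrightarrow> prim_rec (\<lambda>x e. rule_action act (c x e))"
proof -
  assume c: "prim_rec c"
  have move: "prim_rec (\<lambda>x e. move_in m (f x e))" if "prim_rec f" for m f
    using that prim_rec_diff[OF that prim_rec_const[of 1]] by (cases m) (auto intro: prim_rec_intros)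
  then show ?thesis
    using c by (cases act) (auto intro!: prim_rec_intros move prim_rec_tapes_action)
qed

text \<open>The program is a fixed list, so the lookup unfolds into finitely many case
  distinctions.\<close>

lemma prim_rec_rules_action:
  "prim_rec a \<Longrightarrow> prim_rec c \<Longrightarrow> prim_rec (\<lambda>x e. rules_action rs (a x e) (c x e))"
proof (induction rs)
  case (Cons r rs)
  obtain q a' xs act where "r = ((q, a', xs), act)"
    by (metis prod_cases4 surj_pair)
  then show ?case
    using Cons by (auto intro!: prim_rec_intros prim_rec_rule_action prim_rec_scans)
qed (auto intro!: prim_rec_intros)

lemma rules_action:
  assumes "codes_tapes (code_work c) Ts"
    and "\<forall>((s, a, xs), (s', m, ys, b)) \<in> set rs. length xs = length Ts"
  shows "rules_action rs (letter_code a) c =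
    (case map_of rs (code_state c, a, map (\<lambda>(t, h). t h) Ts) of
      None \<Rightarrow> config_code (code_state c) (code_head c) (code_work c) (code_seps c) 0
    | Some act \<Rightarrow> rule_action act c)"
  using assms(2)
proof (induction rs)
  case (Cons r rs)
  obtain q a' xs act where "r = ((q, a', xs), act)"
    by (metis prod_cases4 surj_pair)
  then show ?case
    using Cons scans_iff[OF assms(1), of xs] by (cases act) (auto simp: letter_code_eq_iff)
qed simp

text \<open>The start value 0 codes the initial configuration, since all its components decode to
  0.\<close>

definition simulate :: "tm \<Rightarrow> baire \<Rightarrow> nat \<Rightarrow> nat" where
  "simulate M z s = ((\<lambda>c. rules_action (rules M) (cell_code z (code_head c)) c) ^^ s) 0"

lemma prim_rec_simulate:
  assumes z: "prim_rec (\<lambda>x e. z x (pfst e) (psnd e))" and a: "prim_rec a"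
  shows "prim_rec (\<lambda>x e. simulate M (\<lambda>i. z x i e) (a x e))"
  unfolding simulate_def
  by (intro prim_rec_intros prim_rec_funpow prim_rec_rules_action
      prim_rec_cell_code[where z = "\<lambda>x i e. z x i (psnd e)"] prim_rec_subst[OF z] a)

lemma simulate:
  assumes "turing_machine M"
  shows "code_seps (simulate M z s) = count_list (output_after M z s) Sep"
    and "code_stroke (simulate M z (Suc s)) =
      of_bool (output_after M z (Suc s) = output_after M z s @ [Stroke])"
proof -
  let ?C = "\<lambda>s. (step M z ^^ s) (initial M)"
  \<comment> \<open>The stroke flag is left out: it describes a step, and \<open>step\<close> below
    relates it to two consecutive configurations.\<close>
  define inv where "inv c C \<longleftrightarrow> code_state c = state C \<and> code_head c = in_head C \<and>
    codes_tapes (code_work c) (work C) \<and> code_seps c = count_list (written C) Sep \<and>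
    length (work C) = work_tapes M" for c and C :: config
  have step: "inv (rules_action (rules M) (cell_code z (code_head c)) c) (step M z C) \<and>
      code_stroke (rules_action (rules M) (cell_code z (code_head c)) c) =
        of_bool (written (step M z C) = written C @ [Stroke])" if "inv c C" for c C
  proof -
    let ?k = "(state C, input_cell z (in_head C), map (\<lambda>(t, h). t h) (work C))"
    have lens: "\<forall>((s, a, xs), (s', m, ys, b)) \<in> set (rules M). length xs = length (work C)"
      using assms that by (auto simp: turing_machine_def inv_def)
    have ra: "rules_action (rules M) (cell_code z (code_head c)) c = (case map_of (rules M) ?k of
        None \<Rightarrow> config_code (code_state c) (code_head c) (code_work c) (code_seps c) 0
      | Some act \<Rightarrow> rule_action act c)"
      using rules_action[OF _ lens, of c "input_cell z (in_head C)"] that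
      by (simp add: inv_def cell_code)
    show ?thesis
    proof (cases "map_of (rules M) ?k")
      case None
      then show ?thesis
        using that unfolding ra by (simp add: inv_def step_def)
    next
      case (Some act)
      obtain q m ys b where act: "act = (q, m, ys, b)"
        by (metis prod_cases4)
      have "(?k, q, m, ys, b) \<in> set (rules M)"
        using Some act by (auto dest: map_of_SomeD)
      then have "length ys = length (work C)"
        using assms that by (fastforce simp: turing_machine_def inv_def)
      then show ?thesis
        using that Some unfolding ra
        by (auto simp: inv_def step_def act codes_tapes_action split: option.split)
    qed
  qed
  have inv: "inv (simulate M z s) (?C s)" for s
  proof (induction s)
    case 0
    then show ?case
      by (simp add: inv_def simulate_def initial_def codes_tapes_blank)
  next
    case (Suc s)
    then show ?case
      using step[OF Suc] by (simp add: simulate_def)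
  qed
  then show "code_seps (simulate M z s) = count_list (output_after M z s) Sep"
    by (auto simp: inv_def output_after_def)
  show "code_stroke (simulate M z (Suc s)) =
      of_bool (output_after M z (Suc s) = output_after M z s @ [Stroke])"
    using step[OF inv[of s]] by (simp add: simulate_def output_after_def)
qed

section \<open>Reading the nonzero output blocks off a run\<close>

lemma tm_fun_produces: "tm_fun M z = Some r \<Longrightarrow> produces M z r"
  unfolding tm_fun_def
  by (metis (mono_tags, lifting) option.distinct(1) option.inject produces_unique the_equality)

lemma count_Sep_unary: "count_list (unary r k) Sep = k"
proof (induction k)
  case (Suc k)
  have "count_list (replicate n Stroke) Sep = 0" for n
    by (induction n) auto
  then show ?case
    using Suc by (simp add: unary_Suc)
qed (simp add: unary_def)

text \<open>Each block ends with its separator, so the stroke after \<open>w\<close> lies in the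
  block whose number is the count of separators in \<open>w\<close>.\<close>

lemma Stroke_in_unary: "prefix (w @ [Stroke]) (unary r n) \<Longrightarrow> r (count_list w Sep) \<noteq> 0"
proof (induction n)
  case (Suc n)
  show ?case
  proof (cases "prefix (w @ [Stroke]) (unary r n)")
    case False
    then obtain v where v: "w @ [Stroke] = unary r n @ v" "v \<noteq> []"
      "prefix v (replicate (r n) Stroke @ [Sep])"
      using Suc.prems by (auto simp: unary_Suc prefix_append)
    then obtain v' where v': "v = v' @ [Stroke]" "w = unary r n @ v'"
      by (cases v rule: rev_cases) auto
    then have "prefix (v' @ [Stroke]) (replicate (r n) Stroke)"
      using v(3) by (auto simp: prefix_snoc)
    then have "r n \<noteq> 0" "set v' \<subseteq> {Stroke}"
      by (auto simp: prefix_def dest!: arg_cong[where f = set])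
    then have "count_list v' Sep = 0"
      by (auto simp: count_list_0_iff)
    then show ?thesis
      using v'(2) \<open>r n \<noteq> 0\<close> by (simp add: count_Sep_unary)
  qed (use Suc.IH in simp)
qed (simp add: unary_def)

lemma output_after_Suc:
  "output_after M z (Suc s) = output_after M z s \<or>
   (\<exists>l. output_after M z (Suc s) = output_after M z s @ [l])"
  by (simp add: output_after_def step_def split: option.split prod.split)

definition nonzero_blocks :: "tm \<Rightarrow> baire \<Rightarrow> baire" where
  "nonzero_blocks M z s =
     (if code_stroke (simulate M z s) = 0 then 0 else Suc (code_seps (simulate M z s)))"

text \<open>Output is never revised, so each written stroke occurs in \<open>unary r n\<close> for
  large \<open>n\<close>. Conversely, the first stroke of a nonzero block is written at some step
  and listed then.\<close>

lemma enumerated_nonzero_blocks: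
  assumes M: "turing_machine M" and r: "tm_fun M z = Some r"
  shows "enumerated (nonzero_blocks M z) = {k. r k \<noteq> 0}"
proof (intro set_eqI iffI; unfold mem_Collect_eq)
  fix k
  assume "k \<in> enumerated (nonzero_blocks M z)"
  then obtain s where s: "code_stroke (simulate M z s) \<noteq> 0" "k = code_seps (simulate M z s)"
    by (auto simp: enumerated_def nonzero_blocks_def split: if_splits)
  then obtain s' where s': "s = Suc s'"
    by (cases s) (auto simp: simulate_def)
  let ?w = "output_after M z s'"
  have w: "output_after M z s = ?w @ [Stroke]"
    using s(1) simulate(2)[OF M, of z s'] s' by (auto split: if_splits)
  then have k: "k = count_list ?w Sep"
    using s(2) simulate(1)[OF M, of z s] by simp
  \<comment> \<open>Each block has at least one letter, so \<open>unary r n\<close> is at least as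
    long as the output in question.\<close>
  define n where "n = length (?w @ [Stroke])"
  obtain t where "prefix (unary r n) (output_after M z t)"
    using tm_fun_produces[OF r] unfolding produces_def by blast
  then have "prefix (unary r n) (output_after M z (max s t))"
    "prefix (?w @ [Stroke]) (output_after M z (max s t))"
    unfolding w[symmetric] by (meson output_after_mono prefix_order.trans max.cobounded1 max.cobounded2)+
  then have "prefix (?w @ [Stroke]) (unary r n)"
    using length_unary_ge[of n r] by (auto intro: prefix_length_prefix simp: n_def)
  then show "r k \<noteq> 0"
    unfolding k by (rule Stroke_in_unary)
next
  fix k
  assume k: "r k \<noteq> 0"
  define w where "w = unary r k"
  obtain t where "prefix (unary r (Suc k)) (output_after M z t)"
    using tm_fun_produces[OF r] unfolding produces_def by blast
  moreover have "prefix (w @ [Stroke]) (unary r (Suc k))"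
    using k by (cases "r k") (auto simp: w_def unary_Suc)
  ultimately have "\<exists>t. prefix (w @ [Stroke]) (output_after M z t)"
    by (meson prefix_order.trans)
  moreover have "\<not> prefix (w @ [Stroke]) (output_after M z 0)"
    by (simp add: output_after_def initial_def)
  \<comment> \<open>When the stroke first appears, the output is exactly \<open>w\<close> with this
    stroke, because a step writes at most one letter.\<close>
  ultimately obtain s where s: "prefix (w @ [Stroke]) (output_after M z (Suc s))"
    "\<not> prefix (w @ [Stroke]) (output_after M z s)"
    using ex_least_nat_less[of "\<lambda>t. prefix (w @ [Stroke]) (output_after M z t)"] by blast
  then have *: "output_after M z (Suc s) = w @ [Stroke]" "output_after M z s = w"
    using output_after_Suc[of M z s] by (auto simp: prefix_snoc)
  then have "nonzero_blocks M z (Suc s) = Suc k"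
    using simulate[OF M] by (simp add: nonzero_blocks_def w_def count_Sep_unary)
  then show "k \<in> enumerated (nonzero_blocks M z)"
    unfolding enumerated_def by blast
qed

lemma prim_rec_nonzero_blocks:
  assumes z: "prim_rec (\<lambda>x e. z x (pfst e) (psnd e))" and a: "prim_rec a"
  shows "prim_rec (\<lambda>x e. nonzero_blocks M (\<lambda>i. z x i e) (a x e))"
  unfolding nonzero_blocks_def
  by (intro prim_rec_intros prim_rec_pred_eq0 prim_rec_simulate[OF z] a)

lemma prim_rec_bpair:
  assumes "prim_rec (\<lambda>x e. p x (pfst e) (psnd e))" "prim_rec (\<lambda>x e. q x (pfst e) (psnd e))"
    and "prim_rec a"
  shows "prim_rec (\<lambda>x e. bpair (\<lambda>i. p x i e) (\<lambda>i. q x i e) (a x e))"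
  unfolding bpair_def
  by (intro prim_rec_intros prim_rec_div2 prim_rec_pred_even assms(3)
      prim_rec_subst[OF assms(1)] prim_rec_subst[OF assms(2)] prim_rec_id)

lemma prim_rec_prepend: "prim_rec a \<Longrightarrow> prim_rec (\<lambda>x e. prepend w x (a x e))"
proof (induction w arbitrary: a)
  case Nil
  then show ?case by (simp add: prepend_def prim_rec_query)
next
  case (Cons v w)
  have "prepend (v # w) x i = (if i = 0 then v else prepend w x (i - 1))" for x i
    by (auto simp: prepend_def nth_Cons')
  then show ?case
    by (simp only:) (intro prim_rec_intros prim_rec_pred_eq0 Cons)
qed


section \<open>Reduction of the implication to the enumeration problem\<close>

definition settled :: "baire \<Rightarrow> nat set" where
  "settled p = {c. \<forall>j. p (prod_encode (pfst c, psnd c + j)) = p c}"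

text \<open>The index \<open>e\<close> codes a candidate and a possible witness against it.\<close>

definition unsettled_enum :: "baire \<Rightarrow> baire" where
  "unsettled_enum p e = (if p (prod_encode (pfst (pfst e), psnd (pfst e) + psnd e)) = p (pfst e)
     then 0 else Suc (pfst e))"

lemma enumerated_unsettled_enum: "- enumerated (unsettled_enum p) = settled p"
proof (intro set_eqI)
  fix c
  have "c \<in> settled p" if "\<And>e. unsettled_enum p e \<noteq> Suc c"
    unfolding settled_def
  proof safe
    fix j
    show "p (prod_encode (pfst c, psnd c + j)) = p c"
      using that[of "prod_encode (c, j)"] by (auto simp: unsettled_enum_def split: if_splits)
  qed
  then show "c \<in> - enumerated (unsettled_enum p) \<longleftrightarrow> c \<in> settled p"
    by (auto simp: enumerated_def settled_def unsettled_enum_def split: if_splits)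
qed

lemma prim_rec_unsettled_enum: "prim_rec unsettled_enum"
  unfolding unsettled_enum_def by (intro prim_rec_intros)

text \<open>The index codes \<langle>m,\<langle>i,j\<rangle>\<rangle>: the bound \<open>m\<close> is
  refuted when stage \<open>i\<close> of \<open>r\<close> lists some \<open>c \<ge> m\<close> that
  \<open>j\<close> shows to be unsettled.\<close>

definition bad_bounds :: "baire \<Rightarrow> baire \<Rightarrow> baire" where
  "bad_bounds p r e = (let m = pfst e; u = r (pfst (psnd e)) in
     if u \<noteq> 0 \<and> m \<le> u - 1 \<and>
       p (prod_encode (pfst (u - 1), psnd (u - 1) + psnd (psnd e))) \<noteq> p (u - 1) then Suc m else 0)"

lemma good_bounds_iff:
  "m \<in> - enumerated (bad_bounds p r) \<longleftrightarrow> (\<forall>c \<in> enumerated r. m \<le> c \<longrightarrow> c \<in> settled p)"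
proof -
  have "m \<in> enumerated (bad_bounds p r)" if c: "c \<in> enumerated r" "m \<le> c" "c \<notin> settled p" for c
  proof -
    obtain i where "r i = Suc c"
      using c(1) by (auto simp: enumerated_def)
    moreover obtain j where "p (prod_encode (pfst c, psnd c + j)) \<noteq> p c"
      using c(3) by (auto simp: settled_def)
    ultimately have "bad_bounds p r (prod_encode (m, prod_encode (i, j))) = Suc m"
      using c(2) by (simp add: bad_bounds_def)
    then show ?thesis
      unfolding enumerated_def by blast
  qed
  moreover have "\<exists>c \<in> enumerated r. m \<le> c \<and> c \<notin> settled p" if m: "m \<in> enumerated (bad_bounds p r)"
  proof -
    obtain e where e: "bad_bounds p r e = Suc m"
      using m by (auto simp: enumerated_def)
    then obtain c where "r (pfst (psnd e)) = Suc c"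
      by (cases "r (pfst (psnd e))") (auto simp: bad_bounds_def Let_def)
    then show ?thesis
      using e by (auto simp: bad_bounds_def Let_def enumerated_def settled_def split: if_splits)
  qed
  ultimately show ?thesis
    by blast
qed

text \<open>Here \<open>z\<close> is \<open>bpair (bpair p r) y\<close> with a bound
  \<open>y 0\<close>, and \<open>e\<close> codes the output index and a stage of \<open>r\<close>.
  Only pairs that are listed there, belong to this index and respect the bound are accepted.\<close>

definition search_limit :: "baire \<Rightarrow> nat \<Rightarrow> nat" where
  "search_limit z e = (let u = bsnd (bfst z) (psnd e) in
     if u \<noteq> 0 \<and> pfst (u - 1) = pfst e \<and> bsnd z 0 \<le> u - 1 then Suc (bfst (bfst z) (u - 1)) else 0)"

lemma prim_rec_double: "prim_rec a \<Longrightarrow> prim_rec (\<lambda>x e. 2 * a x e)"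
  using prim_rec_add[of a a] by (simp add: mult_2)

lemma prim_rec_search_limit: "prim_rec search_limit"
  unfolding search_limit_def Let_def bfst_def bsnd_def
  by (intro prim_rec_intros prim_rec_double)

text \<open>The search ends: column \<open>n\<close> has infinitely many settled pairs, of which
  only finitely many are below the bound or missing from \<open>enumerated r\<close>. It is correct:
  what is accepted is settled by the hypothesis on \<open>y 0\<close>, and so carries the
  limit.\<close>

lemma search_limit:
  assumes lim: "\<And>n. (\<lambda>i. p (prod_encode (n, i))) \<longlonglongrightarrow> L n"
    and fin: "finite ((settled p - enumerated r) \<union> (enumerated r - settled p))"
    and m: "\<forall>c \<in> enumerated r. y 0 \<le> c \<longrightarrow> c \<in> settled p"
  shows "\<exists>j. search_limit (bpair (bpair p r) y) (prod_encode (n, j)) = Suc (L n) \<and>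
    (\<forall>i<j. search_limit (bpair (bpair p r) y) (prod_encode (n, i)) = 0)"
proof -
  let ?g = "\<lambda>j. search_limit (bpair (bpair p r) y) (prod_encode (n, j))"
  obtain I where I: "\<And>i. i \<ge> I \<Longrightarrow> p (prod_encode (n, i)) = L n"
    using lim[of n] by (auto simp: tendsto_discrete eventually_sequentially)
  define S where "S = (\<lambda>i. prod_encode (n, i)) ` {I..}"
  have "S \<subseteq> settled p"
    by (auto simp: S_def settled_def I)
  have "infinite S"
    unfolding S_def by (subst finite_image_iff) (auto simp: inj_on_def infinite_Ici)
  then have "infinite (S - ((settled p - enumerated r) \<union> (enumerated r - settled p)) - {..<y 0})"
    using fin by (intro Diff_infinite_finite) auto
  then obtain c where "c \<in> S - ((settled p - enumerated r) \<union> (enumerated r - settled p)) - {..<y 0}"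
    by (metis ex_in_conv finite.emptyI)
  then obtain j0 where j0: "r j0 = Suc c" "y 0 \<le> c" "pfst c = n"
    using \<open>S \<subseteq> settled p\<close> by (auto simp: S_def enumerated_def)
  then have "?g j0 \<noteq> 0"
    by (simp add: search_limit_def)
  then obtain j where j: "?g j \<noteq> 0" "\<And>i. i < j \<Longrightarrow> ?g i = 0"
    using exists_least_iff[of "\<lambda>j. ?g j \<noteq> 0"] by auto
  obtain c where c: "r j = Suc c" "pfst c = n" "y 0 \<le> c" "?g j = Suc (p c)"
    using j(1) by (cases "r j") (auto simp: search_limit_def Let_def split: if_splits)
  have "c \<in> settled p"
    using m c by (auto simp: enumerated_def)
  \<comment> \<open>The index \<open>psnd c + I\<close> is at least \<open>psnd c\<close> and at
    least \<open>I\<close>, so both descriptions of the column apply to it.\<close>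
  then have "p (prod_encode (n, psnd c + I)) = p c"
    using c(2) by (auto simp: settled_def)
  then have "p c = L n"
    using I[of "psnd c + I"] by simp
  then show ?thesis
    using c(4) j(2) by auto
qed

section \<open>Functions from numbers to sequences as points of the function space\<close>

lemma nat_names: "mv_inv (cyl nat_space) n = {y. y 0 = n}"
  \<comment> \<open>\<open>bfst y 0\<close> is \<open>y 0\<close>, so passing to cylindrical names
    changes nothing for numbers.\<close>
  by (auto simp: mv_inv_def cyl_def nat_space_def bfst_def)

text \<open>Composition of multi-valued maps demands definedness on all names of \<open>n\<close>,
  hence the quantified hypothesis; the common value makes the result a singleton.\<close>

lemma Phi_space_eqI:
  assumes "\<And>y. y 0 = n \<Longrightarrow> Phi U h y = Some L"
  shows "Phi_space U nat_space baire_space h n = {L}"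
proof -
  define F where "F = mv baire_space \<circ>\<^sub>m\<^sub>v mv (Phi U h)"
  have "F y = {L}" if "y 0 = n" for y
    using assms[of y, OF that] by (simp add: F_def mcomp_def mdom_def mv_def baire_space_def)
  moreover have "\<exists>y :: baire. y 0 = n"
    by (rule exI[of _ "\<lambda>_. n"]) simp
  ultimately show ?thesis
    unfolding Phi_space_def F_def[symmetric] by (auto simp: mcomp_def mdom_def nat_names)
qed

lemma Phi_space_defined:
  assumes "n \<in> mdom (Phi_space U nat_space baire_space h)" "y 0 = n"
  obtains L where "Phi U h y = Some L" "L \<in> Phi_space U nat_space baire_space h n"
proof -
  have "\<forall>y. y 0 = n \<longrightarrow> (\<exists>L. Phi U h y = Some L)"
    using assms(1) unfolding Phi_space_def mcomp_def mdom_def nat_names mv_def baire_space_def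
    by auto
  moreover from this obtain L where L: "Phi U h y = Some L"
    using assms(2) by blast
  ultimately have "L \<in> Phi_space U nat_space baire_space h n"
    using assms(2) unfolding Phi_space_def mcomp_def mdom_def nat_names mv_def baire_space_def
    by auto
  then show thesis
    using L that by blast
qed

text \<open>Universality is applied to the search machine: prefixing \<open>w\<close> turns
  \<open>x\<close> into a name of the function that runs the search.\<close>

lemma ex_search_program:
  assumes "universal U"
  shows "\<exists>w. \<forall>x y r. (\<forall>n. \<exists>j. search_limit (bpair x y) (prod_encode (n, j)) = Suc (r n) \<and>
      (\<forall>i<j. search_limit (bpair x y) (prod_encode (n, i)) = 0)) \<longrightarrow>
    tm_fun U (bpair (prepend w x) y) = Some r"
  using ex_tm_search[OF prim_rec_search_limit] assms unfolding universal_def by metis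

text \<open>The program returns the same limit from every good bound, and a good bound exists
  because \<open>r\<close> lists only finitely many unsettled numbers.\<close>

lemma implication_solution:
  assumes w: "\<forall>x y r. (\<forall>n. \<exists>j. search_limit (bpair x y) (prod_encode (n, j)) = Suc (r n) \<and>
      (\<forall>i<j. search_limit (bpair x y) (prod_encode (n, i)) = 0)) \<longrightarrow>
    tm_fun U (bpair (prepend w x) y) = Some r"
    and p: "p \<in> mdom (mvfun Lim_problem)"
    and fin: "finite ((settled p - enumerated r) \<union> (enumerated r - settled p))"
  shows "(Phi_space U nat_space baire_space (prepend w (bpair p r)), - enumerated (bad_bounds p r))
    \<in> mvfun (implication U C_Nat Lim_problem) p"
proof -
  let ?F = "Phi_space U nat_space baire_space (prepend w (bpair p r))"
  let ?X = "- enumerated (bad_bounds p r)"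
  obtain L where L: "\<And>n. (\<lambda>i. p (prod_encode (n, i))) \<longlonglongrightarrow> L n"
    using p by (auto simp: mdom_def Lim_problem_def)
  have F: "?F n = {L}" if "n \<in> ?X" for n
  proof (rule Phi_space_eqI)
    fix y :: baire
    assume "y 0 = n"
    then have "\<forall>c \<in> enumerated r. y 0 \<le> c \<longrightarrow> c \<in> settled p"
      using that good_bounds_iff by blast
    then show "Phi U (prepend w (bpair p r)) y = Some L"
      unfolding Phi_def using search_limit[OF L fin] by (intro w[rule_format]) blast
  qed
  obtain b where "\<forall>c \<in> enumerated r - settled p. c < b"
    using fin by (meson finite_Un finite_nat_set_iff_bounded)
  then have "b \<in> ?X"
    unfolding good_bounds_iff by (metis DiffI not_less)
  then have "?X \<in> mdom (?F \<circ>\<^sub>m\<^sub>v mvfun C_Nat)" "(?F \<circ>\<^sub>m\<^sub>v mvfun C_Nat) ?X = {L}"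
    using F by (auto simp: mdom_def mcomp_def C_Nat_def)
  moreover have "?F \<in> points (M_space U (target C_Nat) (target Lim_problem))"
    by (auto simp: ran_def M_space_def C_Nat_def Lim_problem_def)
  moreover have "?X \<in> points (source C_Nat)"
    by (auto simp: ran_def closed_space_def C_Nat_def)
  moreover have "L \<in> mvfun Lim_problem p"
    using L by (simp add: Lim_problem_def)
  ultimately show ?thesis
    using p by (simp add: implication_def)
qed

lemma implication_le_Almost_EC:
  assumes "universal U"
  shows "implication U C_Nat Lim_problem \<le>\<^sub>W Almost_EC"
proof -
  obtain w where w: "\<forall>x y r.
      (\<forall>n. \<exists>j. search_limit (bpair x y) (prod_encode (n, j)) = Suc (r n) \<and>
        (\<forall>i<j. search_limit (bpair x y) (prod_encode (n, i)) = 0)) \<longrightarrow>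
      tm_fun U (bpair (prepend w x) y) = Some r"
      using ex_search_program[OF assms] by blast
  define K where "K x = bpair (prepend w x) (bad_bounds (bfst x) (bsnd x))" for x
  have "prim_rec K"
    unfolding K_def bad_bounds_def Let_def bfst_def bsnd_def
    by (intro prim_rec_bpair prim_rec_prepend prim_rec_intros prim_rec_double)
  then have "computable (\<lambda>x. Some (K x))" "computable (\<lambda>p. Some (unsettled_enum p))"
    using prim_rec_unsettled_enum by (simp_all add: computable_prim_rec)
  moreover have "(\<lambda>p. Option.bind (Option.bind (Some (unsettled_enum p)) G)
      (\<lambda>r. Some (K (bpair p r)))) \<turnstile> implication U C_Nat Lim_problem"
    if G: "G \<turnstile> Almost_EC" for G
    unfolding realizes_def
  proof (intro allI impI)
    fix p x
    assume "source (implication U C_Nat Lim_problem) p = Some x \<and>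
      x \<in> mdom (mvfun (implication U C_Nat Lim_problem))"
    then have p: "x = p" "p \<in> mdom (mvfun Lim_problem)"
      by (auto simp: implication_def Lim_problem_def baire_space_def mdom_def)
    have "source Almost_EC (unsettled_enum p) = Some (settled p)"
      "settled p \<in> mdom (mvfun Almost_EC)"
      by (auto simp: Almost_EC_def closed_space_def enumerated_unsettled_enum mdom_def
          intro: exI[of _ "settled p"])
    then obtain r where r: "G (unsettled_enum p) = Some r"
      "finite ((settled p - enumerated r) \<union> (enumerated r - settled p))"
      using G unfolding realizes_def by (fastforce simp: Almost_EC_def open_space_def)
    have "target (implication U C_Nat Lim_problem) (K (bpair p r)) =
        Some (Phi_space U nat_space baire_space (prepend w (bpair p r)), - enumerated (bad_bounds p r))"
      by (simp add: implication_def prod_space_def M_space_def closed_space_def K_def C_Nat_def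
          Lim_problem_def)
    then show "\<exists>q y. Option.bind (Option.bind (Some (unsettled_enum p)) G)
        (\<lambda>r. Some (K (bpair p r))) = Some q \<and>
        target (implication U C_Nat Lim_problem) q = Some y \<and>
        y \<in> mvfun (implication U C_Nat Lim_problem) x"
      using implication_solution[OF w p(2) r(2)] r(1) p(1) by auto
  qed
  ultimately show ?thesis
    unfolding weihrauch_le_def by blast
qed


section \<open>Reduction of the enumeration problem to the implication\<close>

definition approx :: "baire \<Rightarrow> baire" where
  "approx p e = (if \<exists>i<psnd e. p i = Suc (pfst e) then 0 else 1)"

lemma approx_tendsto:
  "(\<lambda>i. approx p (prod_encode (n, i))) \<longlonglongrightarrow> of_bool (n \<in> - enumerated p)"
proof (cases "n \<in> enumerated p")
  case True
  then obtain j where j: "p j = Suc n"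
    by (auto simp: enumerated_def)
  then have "approx p (prod_encode (n, i)) = 0" if "i > j" for i
    using that by (auto simp: approx_def)
  then have "eventually (\<lambda>i. approx p (prod_encode (n, i)) = 0) sequentially"
    by (meson eventually_sequentiallyI less_eq_Suc_le)
  then show ?thesis
    using True by (simp add: tendsto_discrete)
next
  case False
  then have "approx p (prod_encode (n, i)) = 1" for i
    by (auto simp: approx_def enumerated_def)
  then show ?thesis
    using False by simp
qed

text \<open>The least number not listed before stage \<open>s\<close>: \<open>s\<close> rounds
  suffice, since \<open>s\<close> entries list at most \<open>s\<close> numbers.\<close>

definition guess :: "baire \<Rightarrow> nat \<Rightarrow> nat" where
  "guess q s = ((\<lambda>y. if \<exists>i<s. q i = Suc y then Suc y else y) ^^ s) 0"

lemma guess_stabilizes: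
  assumes "- enumerated q \<noteq> {}"
  obtains n s0 where "n \<in> - enumerated q" "\<And>s. s \<ge> s0 \<Longrightarrow> guess q s = n"
proof -
  define n where "n = (LEAST n. n \<in> - enumerated q)"
  have n: "n \<in> - enumerated q"
    unfolding n_def using assms by (metis LeastI ex_in_conv)
  have "\<exists>i. q i = Suc m" if "m < n" for m
    using not_less_Least[OF that[unfolded n_def]] by (auto simp: enumerated_def)
  then obtain I where I: "\<And>m. m < n \<Longrightarrow> q (I m) = Suc m"
    by metis
  \<comment> \<open>From stage \<open>s0\<close> on all numbers below \<open>n\<close> have been
    listed, and the summand \<open>n\<close> ensures enough rounds to climb to
    \<open>n\<close>.\<close>
  define s0 where "s0 = n + (\<Sum>m<n. Suc (I m))"
  have "guess q s = n" if s: "s \<ge> s0" for s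
  proof -
    define f where "f y = (if \<exists>i<s. q i = Suc y then Suc y else y)" for y
    have f: "f m = Suc m" if "m < n" for m
    proof -
      have "Suc (I m) \<le> (\<Sum>m<n. Suc (I m))"
        using that by (intro member_le_sum) auto
      then have "\<exists>i<s. q i = Suc m"
        using s I[OF that] by (intro exI[of _ "I m"]) (auto simp: s0_def)
      then show ?thesis
        by (simp add: f_def)
    qed
    have "f n = n"
      using n by (auto simp: enumerated_def f_def)
    then have "(f ^^ k) 0 = min k n" for k
      by (induction k) (auto simp: min_def f not_le le_less)
    moreover have "guess q s = (f ^^ s) 0"
      unfolding guess_def f_def ..
    ultimately show ?thesis
      using s by (simp add: s0_def)
  qed
  then show thesis
    using n that by blast
qed

text \<open>Once the guess is final, the stages of this enumeration are those of a fixed run of the machine;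
  the finitely many earlier stages cost finitely many numbers only.\<close>

lemma finite_diff_eventually_eq:
  assumes "\<And>s. s \<ge> s0 \<Longrightarrow> p s = q s"
  shows "finite (enumerated p - enumerated q)"
proof -
  have "enumerated p - enumerated q \<subseteq> (\<lambda>s. p s - 1) ` {..<s0}"
  proof
    fix k
    assume k: "k \<in> enumerated p - enumerated q"
    then obtain s where s: "p s = Suc k"
      by (auto simp: enumerated_def)
    then have "s < s0"
      using k assms[of s] by (fastforce simp: enumerated_def not_less)
    then show "k \<in> (\<lambda>s. p s - 1) ` {..<s0}"
      using s by (intro image_eqI[of _ _ s]) auto
  qed
  then show ?thesis
    by (rule finite_subset) simp
qed

lemma Almost_EC_le_implication:
  assumes "universal U"
  shows "Almost_EC \<le>\<^sub>W implication U C_Nat Lim_problem"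
proof -
  \<comment> \<open>\<open>U\<close> receives the name of the function and the constant sequence of
    the current guess, which is a name of that number.\<close>
  define K where "K x s = nonzero_blocks U
    (bpair (bfst (bsnd x)) (\<lambda>_. guess (bsnd (bsnd x)) s)) s" for x s
  have "prim_rec K"
    unfolding K_def guess_def bfst_def bsnd_def
    by (intro prim_rec_nonzero_blocks prim_rec_bpair prim_rec_funpow prim_rec_intros prim_rec_double)
  moreover have "prim_rec approx"
    unfolding approx_def by (intro prim_rec_intros)
  ultimately have "computable (\<lambda>x. Some (K x))" "computable (\<lambda>p. Some (approx p))"
    by (simp_all add: computable_prim_rec)
  moreover have "(\<lambda>p. Option.bind (Option.bind (Some (approx p)) G)
      (\<lambda>r. Some (K (bpair p r)))) \<turnstile> Almost_EC"
    if G: "G \<turnstile> implication U C_Nat Lim_problem" for G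
    unfolding realizes_def
  proof (intro allI impI)
    fix p A
    assume "source Almost_EC p = Some A \<and> A \<in> mdom (mvfun Almost_EC)"
    then have A: "A = - enumerated p"
      by (auto simp: Almost_EC_def closed_space_def)
    let ?L = "\<lambda>n. of_bool (n \<in> A) :: nat"
    have lim: "approx p \<in> mdom (mvfun Lim_problem)"
      using approx_tendsto[of p] A by (auto simp: mdom_def Lim_problem_def intro!: exI[of _ ?L])
    obtain w where w: "\<forall>x y r.
      (\<forall>n. \<exists>j. search_limit (bpair x y) (prod_encode (n, j)) = Suc (r n) \<and>
        (\<forall>i<j. search_limit (bpair x y) (prod_encode (n, i)) = 0)) \<longrightarrow>
      tm_fun U (bpair (prepend w x) y) = Some r"
      using ex_search_program[OF assms] by blast
    \<comment> \<open>Applying \<open>G\<close> requires that the implication has a solution at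
      \<open>approx p\<close>. The converse construction supplies one from any enumeration of the
      settled set; \<open>r0\<close> serves for this existence only and is not computed.\<close>
    define r0 where "r0 c = (if c \<in> settled (approx p) then Suc c else 0)" for c
    have "enumerated r0 = settled (approx p)"
      by (auto simp: enumerated_def r0_def split: if_splits)
    then have "approx p \<in> mdom (mvfun (implication U C_Nat Lim_problem))"
      using implication_solution[OF w lim, of r0] by (auto simp: mdom_def)
    moreover have "source (implication U C_Nat Lim_problem) (approx p) = Some (approx p)"
      by (simp add: implication_def Lim_problem_def baire_space_def)
    ultimately have "\<exists>r FX. G (approx p) = Some r \<and>
        target (implication U C_Nat Lim_problem) r = Some FX \<and>
        FX \<in> mvfun (implication U C_Nat Lim_problem) (approx p)"
      using G unfolding realizes_def by blast
    then obtain r F X where r: "G (approx p) = Some r"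
      "target (implication U C_Nat Lim_problem) r = Some (F, X)"
      "(F, X) \<in> mvfun (implication U C_Nat Lim_problem) (approx p)"
      by (metis surj_pair)
    let ?h = "bfst r" and ?q = "bsnd r"
    have F: "F = Phi_space U nat_space baire_space ?h" and X: "X = - enumerated ?q"
      using r(2) by (auto simp: implication_def prod_space_def M_space_def closed_space_def
          C_Nat_def Lim_problem_def)
    have "X \<in> mdom (F \<circ>\<^sub>m\<^sub>v mvfun C_Nat)" "(F \<circ>\<^sub>m\<^sub>v mvfun C_Nat) X \<subseteq> mvfun Lim_problem (approx p)"
      using r(3) by (auto simp: implication_def)
    then have X': "X \<noteq> {}" "X \<subseteq> mdom F" "\<And>n. n \<in> X \<Longrightarrow> F n \<subseteq> mvfun Lim_problem (approx p)"
      by (auto simp: mdom_def mcomp_def C_Nat_def)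
    obtain n s0 where n: "n \<in> X" "\<And>s. s \<ge> s0 \<Longrightarrow> guess ?q s = n"
      using guess_stabilizes X'(1) X by metis
    let ?z = "bpair ?h (\<lambda>_. n)"
    obtain L where L: "Phi U ?h (\<lambda>_. n) = Some L" "L \<in> F n"
      using Phi_space_defined[of n U ?h "\<lambda>_. n"] X'(2) n(1) F by auto
    have "L k = ?L k" for k
    proof -
      have "(\<lambda>i. approx p (prod_encode (k, i))) \<longlonglongrightarrow> L k"
        using X'(3)[OF n(1)] L(2) by (auto simp: Lim_problem_def)
      then show ?thesis
        using approx_tendsto[of p k] A LIMSEQ_unique by blast
    qed
    then have "enumerated (nonzero_blocks U ?z) = A"
      using enumerated_nonzero_blocks[of U ?z L] L(1) assms
      by (auto simp: Phi_def universal_def)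
    moreover have "K (bpair p r) s = nonzero_blocks U ?z s" if "s \<ge> s0" for s
      using n(2)[OF that] by (simp add: K_def)
    \<comment> \<open>The two enumerations agree from stage \<open>s0\<close> on, so each lists only
      finitely many numbers that the other misses.\<close>
    ultimately have "finite (A - enumerated (K (bpair p r)))" "finite (enumerated (K (bpair p r)) - A)"
      using finite_diff_eventually_eq[of s0 "K (bpair p r)" "nonzero_blocks U ?z"]
        finite_diff_eventually_eq[of s0 "nonzero_blocks U ?z" "K (bpair p r)"] by auto
    then show "\<exists>q y. Option.bind (Option.bind (Some (approx p)) G)
        (\<lambda>r. Some (K (bpair p r))) = Some q \<and> target Almost_EC q = Some y \<and> y \<in> mvfun Almost_EC A"
      using r(1) by (simp add: Almost_EC_def open_space_def)
  qed
  ultimately show ?thesis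
    unfolding weihrauch_le_def by blast
qed

theorem proposition6p2:
  fixes U :: tm
  assumes "universal U"
  shows "Almost_EC \<equiv>\<^sub>W implication U C_Nat Lim_problem"
  using Almost_EC_le_implication[OF assms] implication_le_Almost_EC[OF assms]
  by (simp add: weihrauch_eq_def)

end
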